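(* For every uncountable cardinal $\delta$, the following are equivalent: (1) $\delta$ is a subtle cardinal. (2) For every set $\mathcal{C}$ of structures of the same type with $\mathcal{C}\subseteq V_\delta$, there exists a cardinal $\kappa<\delta$ such that $\mathrm{WPSR}_{\mathcal{C}}(\kappa)$ holds.
   Context: Work in ZFC. "Structure" means a structure for a countable first-order language; cardinality of a structure is that of its domain. An infinite cardinal $\delta$ is subtle if for every sequence $\langle E_\gamma:\gamma<\delta\rangle$ with $E_\gamma\subseteq\gamma$ for all $\gamma$ and every closed unbounded $C\subseteq\delta$ there exist $\beta<\gamma$ in $C$ with $E_\beta=E_\gamma\cap\beta$. For a set $S$ of structures of the same type, the product $\prod S$ is the structure whose universe is the set of all functions $f$ with domain $S$ such that $f(\mathcal{A})$ belongs to the universe of $\mathcal{A}$ for every $\mathcal{A}\in S$, with constants, functions and relations interpreted pointwise. Homomorphisms are in the usual model-theoretic sense. For an infinite cardinal $\kappa$ and a class $\mathcal{C}$ of structures of the same type, $\mathrm{WPSR}_{\mathcal{C}}(\kappa)$ is the statement that $\mathcal{C}\cap V_\kappa\neq\emptyset$ and for every substructure $X$ of $\prod(\mathcal{C}\cap V_\kappa)$ of cardinality at most $\kappa$ and every $B\in\mathcal{C}$, there exists a homomorphism from $X$ to $B$.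
   Formalization: In (2) the set C is required to be nonempty; for C empty, WPSR_C(κ) fails for every κ because it demands that C ∩ V_κ be nonempty, so the literal statement would fail at every subtle cardinal. *)

theory Defs
  imports Main "HOL-Library.Countable_Set" "HOL-Library.Equipollence"
begin

text \<open>
  A universe of sets satisfying ZFC. The schemes of separation and replacement range over all
  HOL predicates and functions, so that HOL sets and functions on the universe play the
  role of classes, and a HOL function restricted to a set is itself (coded by) a set.
\<close>

class zfc =
  fixes elts :: "'a \<Rightarrow> 'a set"
  assumes extensionality: "elts x = elts y \<Longrightarrow> x = y"
    and foundation: "wf {(x, y). x \<in> elts y}"
    and pairing: "\<exists>z. elts z = {x, y}"
    and union: "\<exists>z. elts z = (\<Union>y\<in>elts x. elts y)"
    and power_set: "\<exists>z. elts z = {y. elts y \<subseteq> elts x}"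
    and infinity: "\<exists>w. (\<exists>y\<in>elts w. elts y = {}) \<and>
                      (\<forall>y\<in>elts w. \<exists>z\<in>elts w. elts z = insert y (elts y))"
    and separation: "\<exists>z. elts z = {y \<in> elts x. P y}"
    and replacement: "\<exists>z. elts z = F ` elts x"
    and choice: "(\<forall>y\<in>elts x. elts y \<noteq> {}) \<Longrightarrow>
                 (\<forall>y\<in>elts x. \<forall>z\<in>elts x. y \<noteq> z \<longrightarrow> elts y \<inter> elts z = {}) \<Longrightarrow>
                 \<exists>c. \<forall>y\<in>elts x. \<exists>!u. u \<in> elts c \<and> u \<in> elts y"

definition small :: "'v::zfc set \<Rightarrow> bool" where
  "small A \<longleftrightarrow> (\<exists>x. elts x = A)"

text \<open>The set with the given elements; meaningful only for small collections.\<close>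

definition vset :: "'v::zfc set \<Rightarrow> 'v" where
  "vset A = (THE x. elts x = A)"

lemma elts_vset: "small A \<Longrightarrow> elts (vset A) = A"
  unfolding small_def vset_def by (metis (mono_tags, lifting) extensionality the_equality)

lemma vset_elts [simp]: "vset (elts x) = x"
  by (metis elts_vset extensionality small_def)

lemma small_elts [simp]: "small (elts x)"
  by (auto simp: small_def)

lemma small_subset: "small B \<Longrightarrow> A \<subseteq> B \<Longrightarrow> small A"
proof -
  assume "small B" "A \<subseteq> B"
  then obtain x where "elts x = B" by (auto simp: small_def)
  moreover obtain z where "elts z = {y \<in> elts x. y \<in> A}" using separation[of x "\<lambda>y. y \<in> A"] by blast
  ultimately show ?thesis using \<open>A \<subseteq> B\<close> unfolding small_def by (intro exI[of _ z]) auto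
qed

lemma small_image:
  fixes F :: "'v::zfc \<Rightarrow> 'v"
  shows "small A \<Longrightarrow> small (F ` A)"
  unfolding small_def using replacement[where F = F] by blast

lemma small_insert:
  assumes "small A" shows "small (insert x A)"
proof -
  obtain a where a: "elts a = A" using assms by (auto simp: small_def)
  obtain s where s: "elts s = {x, x}" using pairing[of x x] by blast
  obtain p where p: "elts p = {s, a}" using pairing[of s a] by blast
  obtain u where "elts u = (\<Union>y\<in>elts p. elts y)" using union[of p] by blast
  with a s p show ?thesis unfolding small_def by (intro exI[of _ u]) simp
qed

lemma small_empty [simp]: "small {}"
proof -
  obtain x :: 'a where True by blast
  show ?thesis by (rule small_subset[OF small_elts[of x]]) simp
qed

lemma small_UN:
  fixes F :: "'v::zfc \<Rightarrow> 'v set"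
  assumes "small A" "\<And>x. x \<in> A \<Longrightarrow> small (F x)"
  shows "small (\<Union>x\<in>A. F x)"
proof -
  obtain a where a: "elts a = (\<lambda>x. vset (F x)) ` A"
    using small_image[OF assms(1), of "\<lambda>x. vset (F x)"] unfolding small_def by blast
  obtain u where "elts u = (\<Union>y\<in>elts a. elts y)" using union[of a] by blast
  with a have "elts u = (\<Union>x\<in>A. F x)" by (simp add: elts_vset assms(2))
  then show ?thesis unfolding small_def by blast
qed

lemma small_Pow: "small {y. elts y \<subseteq> elts (x::'v::zfc)}"
  unfolding small_def by (rule power_set)

definition opair :: "'v::zfc \<Rightarrow> 'v \<Rightarrow> 'v" where
  "opair x y = vset {vset {x}, vset {x, y}}"

definition vfst :: "'v::zfc \<Rightarrow> 'v" where
  "vfst p = (THE x. \<exists>y. p = opair x y)"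

definition vsnd :: "'v::zfc \<Rightarrow> 'v" where
  "vsnd p = (THE y. \<exists>x. p = opair x y)"

lemma opair_inject [simp]: "opair a b = opair c d \<longleftrightarrow> a = c \<and> b = d"
proof -
  have [simp]: "elts (vset {x, y}) = {x, y}" "elts (vset {x}) = {x}" for x y :: 'a
    by (simp_all add: elts_vset small_insert)
  have *: "vset A = vset B \<longleftrightarrow> A = B" if "small A" "small B" for A B :: "'a set"
    using that by (metis elts_vset)
  show ?thesis
    unfolding opair_def by (auto simp: * small_insert doubleton_eq_iff)
qed

lemma vfst_opair [simp]: "vfst (opair x y) = x"
  by (simp add: vfst_def)

lemma vsnd_opair [simp]: "vsnd (opair x y) = y"
  by (simp add: vsnd_def)

text \<open>Functions as sets of ordered pairs: the graph of \<open>F\<close> on the set \<open>A\<close>, and application.\<close>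

definition graph :: "'v::zfc \<Rightarrow> ('v \<Rightarrow> 'v) \<Rightarrow> 'v" where
  "graph A F = vset ((\<lambda>x. opair x (F x)) ` elts A)"

definition app :: "'v::zfc \<Rightarrow> 'v \<Rightarrow> 'v" where
  "app f x = (THE y. opair x y \<in> elts f)"

lemma elts_graph: "elts (graph A F) = (\<lambda>x. opair x (F x)) ` elts A"
  unfolding graph_def by (intro elts_vset small_image small_elts)

lemma app_graph [simp]: "x \<in> elts A \<Longrightarrow> app (graph A F) x = F x"
  by (auto simp: app_def elts_graph)

definition tuple :: "'v::zfc list \<Rightarrow> 'v" where
  "tuple xs = foldr opair xs (vset {})"

text \<open>The tuples with entries in \<open>A\<close> and length \<open>n\<close> (the length is not recorded in the code).\<close>

definition seqs :: "'v::zfc \<Rightarrow> nat \<Rightarrow> 'v list set" where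
  "seqs A n = {xs. set xs \<subseteq> elts A \<and> length xs = n}"

lemma tuple_inject: "length xs = length ys \<Longrightarrow> tuple xs = tuple ys \<longleftrightarrow> xs = ys"
  by (induction xs ys rule: list_induct2) (auto simp: tuple_def)

lemma small_tuples: "small (tuple ` seqs A n)"
proof (induction n)
  case 0
  have "seqs A 0 = {[]}" by (auto simp: seqs_def)
  then show ?case by (simp add: small_insert)
next
  case (Suc n)
  have "small (\<Union>x\<in>elts A. opair x ` tuple ` seqs A n)"
    by (intro small_UN small_image Suc small_elts)
  moreover have "tuple ` seqs A (Suc n) \<subseteq> (\<Union>x\<in>elts A. opair x ` tuple ` seqs A n)"
    by (auto simp: seqs_def length_Suc_conv tuple_def)
  ultimately show ?case by (rule small_subset)
qed


definition ordinal :: "'v::zfc \<Rightarrow> bool" where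
  "ordinal \<alpha> \<longleftrightarrow> (\<forall>\<beta>\<in>elts \<alpha>. elts \<beta> \<subseteq> elts \<alpha> \<and> (\<forall>\<gamma>\<in>elts \<beta>. elts \<gamma> \<subseteq> elts \<beta>))"

definition cardinal :: "'v::zfc \<Rightarrow> bool" where
  "cardinal \<kappa> \<longleftrightarrow> ordinal \<kappa> \<and> (\<forall>\<alpha>\<in>elts \<kappa>. \<not> elts \<alpha> \<approx> elts \<kappa>)"

text \<open>The cumulative hierarchy; \<open>elts_Vlev\<close> is the intended recursion.\<close>

definition Vlev :: "'v::zfc \<Rightarrow> 'v" where
  "Vlev = wfrec {(x, y). x \<in> elts y} (\<lambda>V \<alpha>. vset (\<Union>\<beta>\<in>elts \<alpha>. {x. elts x \<subseteq> elts (V \<beta>)}))"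

lemma elts_Vlev: "elts (Vlev \<alpha>) = (\<Union>\<beta>\<in>elts \<alpha>. {x. elts x \<subseteq> elts (Vlev \<beta>)})"
proof -
  have "Vlev \<alpha> = vset (\<Union>\<beta>\<in>elts \<alpha>. {x. elts x \<subseteq> elts (Vlev \<beta>)})"
    unfolding Vlev_def
    by (subst wfrec[OF foundation])
      (intro arg_cong[of _ _ vset] SUP_cong refl, simp add: cut_apply)
  then show ?thesis
    by (simp add: elts_vset small_UN small_Pow)
qed

definition unbounded_in :: "'v::zfc \<Rightarrow> 'v \<Rightarrow> bool" where
  "unbounded_in C \<mu> \<longleftrightarrow> (\<forall>\<alpha>\<in>elts \<mu>. \<exists>\<beta>\<in>elts C \<inter> elts \<mu>. \<alpha> \<in> elts \<beta>)"

text \<open>A nonempty ordinal in which some set is \<open>unbounded_in\<close> is automatically a limit.\<close>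

definition club :: "'v::zfc \<Rightarrow> 'v \<Rightarrow> bool" where
  "club C \<delta> \<longleftrightarrow> elts C \<subseteq> elts \<delta> \<and> unbounded_in C \<delta> \<and>
    (\<forall>\<mu>\<in>elts \<delta>. elts \<mu> \<noteq> {} \<and> unbounded_in C \<mu> \<longrightarrow> \<mu> \<in> elts C)"

definition subtle :: "'v::zfc \<Rightarrow> bool" where
  "subtle \<delta> \<longleftrightarrow> cardinal \<delta> \<and> infinite (elts \<delta>) \<and>
    (\<forall>E C. (\<forall>\<gamma>\<in>elts \<delta>. elts (E \<gamma>) \<subseteq> elts \<gamma>) \<and> club C \<delta> \<longrightarrow>
      (\<exists>\<beta>\<in>elts C. \<exists>\<gamma>\<in>elts C. \<beta> \<in> elts \<gamma> \<and> elts (E \<beta>) = elts (E \<gamma>) \<inter> elts \<beta>))"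


text \<open>Constants are the function symbols of arity 0.\<close>

record 'v language =
  Fsym :: 'v
  Rsym :: 'v
  farity :: "'v \<Rightarrow> nat"
  rarity :: "'v \<Rightarrow> nat"

definition countable_language :: "'v::zfc language \<Rightarrow> bool" where
  "countable_language L \<longleftrightarrow> countable (elts (Fsym L)) \<and> countable (elts (Rsym L)) \<and>
    (\<forall>R\<in>elts (Rsym L). rarity L R \<ge> 1)"

text \<open>
  A structure is a set: the triple of its universe, the map taking each function symbol to
  (the graph of) its interpretation, and the map taking each relation symbol to its extension.
\<close>

definition mk_structure ::
  "'v::zfc language \<Rightarrow> 'v \<Rightarrow> ('v \<Rightarrow> 'v list \<Rightarrow> 'v) \<Rightarrow> ('v \<Rightarrow> 'v list \<Rightarrow> bool) \<Rightarrow> 'v" where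
  "mk_structure L A F R =
    opair A (opair
      (graph (Fsym L) (\<lambda>f. vset {opair (tuple xs) (F f xs) | xs. xs \<in> seqs A (farity L f)}))
      (graph (Rsym L) (\<lambda>r. vset {tuple xs | xs. xs \<in> seqs A (rarity L r) \<and> R r xs})))"

definition universe :: "'v::zfc \<Rightarrow> 'v" where
  "universe \<A> = vfst \<A>"

definition fun_of :: "'v::zfc \<Rightarrow> 'v \<Rightarrow> 'v list \<Rightarrow> 'v" where
  "fun_of \<A> f xs = app (app (vfst (vsnd \<A>)) f) (tuple xs)"

definition rel_of :: "'v::zfc \<Rightarrow> 'v \<Rightarrow> 'v list \<Rightarrow> bool" where
  "rel_of \<A> r xs \<longleftrightarrow> tuple xs \<in> elts (app (vsnd (vsnd \<A>)) r)"

definition is_structure :: "'v::zfc language \<Rightarrow> 'v \<Rightarrow> bool" where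
  "is_structure L \<A> \<longleftrightarrow> (\<exists>A F R. \<A> = mk_structure L A F R \<and> elts A \<noteq> {} \<and>
    (\<forall>f\<in>elts (Fsym L). \<forall>xs\<in>seqs A (farity L f). F f xs \<in> elts A))"

lemma universe_mk_structure [simp]: "universe (mk_structure L A F R) = A"
  by (simp add: universe_def mk_structure_def)

lemma fun_of_mk_structure:
  assumes "f \<in> elts (Fsym L)" "xs \<in> seqs A (farity L f)"
  shows "fun_of (mk_structure L A F R) f xs = F f xs"
proof -
  let ?S = "seqs A (farity L f)"
  define inv where "inv = inv_into ?S tuple"
  have "inj_on tuple ?S"
    by (rule inj_onI) (simp add: seqs_def tuple_inject)
  then have inv: "inv (tuple ys) = ys" if "ys \<in> ?S" for ys
    using that by (simp add: inv_def)
  have "{opair (tuple ys) (F f ys) | ys. ys \<in> ?S} = (\<lambda>t. opair t (F f (inv t))) ` tuple ` ?S"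
    using inv by (auto simp: image_image Setcompr_eq_image cong: image_cong_simp)
  then have "elts (vset {opair (tuple ys) (F f ys) | ys. ys \<in> ?S})
      = {opair (tuple ys) (F f ys) | ys. ys \<in> ?S}"
    by (simp add: elts_vset small_image small_tuples)
  with assms show ?thesis
    unfolding fun_of_def mk_structure_def
    by (auto simp: app_def[of "vset _"] seqs_def tuple_inject intro!: the_equality)
qed

lemma rel_of_mk_structure:
  assumes "r \<in> elts (Rsym L)" "xs \<in> seqs A (rarity L r)"
  shows "rel_of (mk_structure L A F R) r xs \<longleftrightarrow> R r xs"
proof -
  have "small {tuple ys | ys. ys \<in> seqs A (rarity L r) \<and> R r ys}"
    by (rule small_subset[OF small_tuples[of A "rarity L r"]]) auto
  with assms show ?thesis
    unfolding rel_of_def mk_structure_def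
    by (auto simp: elts_vset seqs_def tuple_inject)
qed

definition product_universe :: "'v::zfc \<Rightarrow> 'v" where
  "product_universe S = vset {graph S F | F. \<forall>\<A>\<in>elts S. F \<A> \<in> elts (universe \<A>)}"

definition product :: "'v::zfc language \<Rightarrow> 'v \<Rightarrow> 'v" where
  "product L S = mk_structure L (product_universe S)
    (\<lambda>f xs. graph S (\<lambda>\<A>. fun_of \<A> f (map (\<lambda>x. app x \<A>) xs)))
    (\<lambda>r xs. \<forall>\<A>\<in>elts S. rel_of \<A> r (map (\<lambda>x. app x \<A>) xs))"

lemma elts_product_universe:
  "elts (product_universe S) = {graph S F | F. \<forall>\<A>\<in>elts S. F \<A> \<in> elts (universe \<A>)}"
proof -
  let ?B = "\<Union>\<A>\<in>elts S. (\<lambda>y. opair \<A> y) ` elts (universe \<A>)"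
  have "small ?B" by (intro small_UN small_image small_elts)
  then obtain b where b: "elts b = ?B" by (auto simp: small_def)
  have "small {graph S F | F. \<forall>\<A>\<in>elts S. F \<A> \<in> elts (universe \<A>)}"
    by (rule small_subset[OF small_Pow[of b]]) (force simp: elts_graph b)
  then show ?thesis by (simp add: product_universe_def elts_vset)
qed

lemma is_structure_mk_structure:
  assumes "elts A \<noteq> {}"
    and "\<And>f xs. f \<in> elts (Fsym L) \<Longrightarrow> xs \<in> seqs A (farity L f) \<Longrightarrow> F f xs \<in> elts A"
  shows "is_structure L (mk_structure L A F R)"
  unfolding is_structure_def
  by (rule exI[of _ A], rule exI[of _ F], rule exI[of _ R]) (use assms in simp)

lemma universe_nonempty: "is_structure L \<A> \<Longrightarrow> elts (universe \<A>) \<noteq> {}"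
  by (auto simp: is_structure_def)

lemma fun_of_closed:
  assumes "is_structure L \<A>" "f \<in> elts (Fsym L)" "xs \<in> seqs (universe \<A>) (farity L f)"
  shows "fun_of \<A> f xs \<in> elts (universe \<A>)"
  using assms by (auto simp: is_structure_def fun_of_mk_structure)

lemma is_structure_product:
  assumes S: "\<forall>\<A>\<in>elts S. is_structure L \<A>"
  shows "is_structure L (product L S)"
proof -
  have "\<forall>\<A>\<in>elts S. (SOME x. x \<in> elts (universe \<A>)) \<in> elts (universe \<A>)"
    using S universe_nonempty by (auto simp: some_in_eq)
  then have "graph S (\<lambda>\<A>. SOME x. x \<in> elts (universe \<A>)) \<in> elts (product_universe S)"
    unfolding elts_product_universe by blast
  moreover have "graph S (\<lambda>\<A>. fun_of \<A> f (map (\<lambda>x. app x \<A>) xs)) \<in> elts (product_universe S)"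
    if f: "f \<in> elts (Fsym L)" and xs: "xs \<in> seqs (product_universe S) (farity L f)" for f xs
  proof -
    have "fun_of \<A> f (map (\<lambda>x. app x \<A>) xs) \<in> elts (universe \<A>)" if "\<A> \<in> elts S" for \<A>
    proof (rule fun_of_closed)
      show "is_structure L \<A>" using S that by blast
      have "app x \<A> \<in> elts (universe \<A>)" if "x \<in> elts (product_universe S)" for x
        using that \<open>\<A> \<in> elts S\<close> by (auto simp: elts_product_universe)
      with xs show "map (\<lambda>x. app x \<A>) xs \<in> seqs (universe \<A>) (farity L f)"
        by (auto simp: seqs_def)
    qed (rule f)
    then show ?thesis by (auto simp: elts_product_universe)
  qed
  ultimately show ?thesis
    unfolding product_def by (intro is_structure_mk_structure) auto
qed

definition substructure :: "'v::zfc language \<Rightarrow> 'v \<Rightarrow> 'v \<Rightarrow> bool" where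
  "substructure L X \<A> \<longleftrightarrow> is_structure L X \<and> elts (universe X) \<subseteq> elts (universe \<A>) \<and>
    (\<forall>f\<in>elts (Fsym L). \<forall>xs\<in>seqs (universe X) (farity L f). fun_of X f xs = fun_of \<A> f xs) \<and>
    (\<forall>r\<in>elts (Rsym L). \<forall>xs\<in>seqs (universe X) (rarity L r). rel_of X r xs \<longleftrightarrow> rel_of \<A> r xs)"

definition homomorphism :: "'v::zfc language \<Rightarrow> ('v \<Rightarrow> 'v) \<Rightarrow> 'v \<Rightarrow> 'v \<Rightarrow> bool" where
  "homomorphism L h \<A> \<B> \<longleftrightarrow> h ` elts (universe \<A>) \<subseteq> elts (universe \<B>) \<and>
    (\<forall>f\<in>elts (Fsym L). \<forall>xs\<in>seqs (universe \<A>) (farity L f).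
      h (fun_of \<A> f xs) = fun_of \<B> f (map h xs)) \<and>
    (\<forall>r\<in>elts (Rsym L). \<forall>xs\<in>seqs (universe \<A>) (rarity L r).
      rel_of \<A> r xs \<longrightarrow> rel_of \<B> r (map h xs))"

text \<open>Here \<open>\<C>\<close> may be a proper class of \<open>L\<close>-structures.\<close>

definition WPSR :: "'v::zfc language \<Rightarrow> 'v set \<Rightarrow> 'v \<Rightarrow> bool" where
  "WPSR L \<C> \<kappa> \<longleftrightarrow> \<C> \<inter> elts (Vlev \<kappa>) \<noteq> {} \<and>
    (\<forall>X. \<forall>B\<in>\<C>. substructure L X (product L (vset (\<C> \<inter> elts (Vlev \<kappa>)))) \<and>
      elts (universe X) \<lesssim> elts \<kappa> \<longrightarrow> (\<exists>h. homomorphism L h X B))"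

end

theory Submission
  imports Defs
begin

text \<open>
  From (1) to (2): if \<open>WPSR\<close> fails at every \<open>\<kappa> < \<delta>\<close>, pick a substructure \<open>X\<^sub>\<kappa>\<close> of
  the product without a homomorphism to some \<open>B\<^sub>\<kappa>\<close>, inject \<open>X\<^sub>\<kappa>\<close> into \<open>\<kappa>\<close> and code its
  atomic diagram as a subset of \<open>\<kappa>\<close>. Subtlety gives \<open>\<kappa> < \<mu>\<close> with coherent codes and \<open>B\<^sub>\<kappa>\<close> of
  rank below \<open>\<mu>\<close>. Coherence yields a homomorphism from \<open>X\<^sub>\<kappa>\<close> to \<open>X\<^sub>\<mu>\<close>, and \<open>B\<^sub>\<kappa>\<close> is a factor
  of the product containing \<open>X\<^sub>\<mu>\<close>, so projecting gives a homomorphism from \<open>X\<^sub>\<kappa>\<close> to \<open>B\<^sub>\<kappa>\<close>.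

  From (2) to (1): let \<open>E\<close> and a club \<open>D\<close> witness that \<open>\<delta>\<close> is not subtle, and let \<open>M\<^sub>\<gamma>\<close>, for
  \<open>\<gamma>\<close> in \<open>D\<close>, have universe \<open>\<gamma> + 1\<close> and relations for the order, \<open>D\<close>, \<open>E\<close> and a system of
  ladders at ordinals of countable cofinality. Given \<open>WPSR\<close> at \<open>\<kappa>\<close>, let \<open>K\<close> be the least element
  of \<open>D\<close> above \<open>\<kappa>\<close>. A homomorphism \<open>h\<close> from a suitable \<open>X\<close> to \<open>M\<^sub>K\<close> induces
  \<open>j(\<alpha>) = h(min \<alpha> \<cdot>)\<close>. A critical point \<open>\<alpha>\<close> of \<open>j\<close> that lies in \<open>D\<close> would make \<open>E\<^sub>\<alpha>\<close> cohere
  with \<open>E\<^bsub>j(\<alpha>)\<^esub>\<close>. One outside \<open>D\<close> lies below a fixed point of \<open>j\<close>, the next element of \<open>D\<close>,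
  so, as in Kunen's inconsistency proof, the supremum of the critical sequence and the ladder on it
  are fixed, which is absurd. Hence \<open>j\<close> is the identity below the least \<open>\<nu>\<close> with \<open>j(\<nu>) = K\<close>.
  Choosing differences between \<open>E\<^bsub>x(\<beta>)\<^esub>\<close> and \<open>E\<^sub>\<eta>\<close> pointwise then produces either a fixed ordinal
  where they both differ and agree, or a smaller value of \<open>h\<close> in \<open>D\<close> above \<open>\<nu>\<close>, and the latter
  cannot go on forever.
\<close>

section \<open>Combinatorics of subtle cardinals in a well-ordered type\<close>

lemma lepoll_iff_card_of: "A \<lesssim> B \<longleftrightarrow> (card_of A, card_of B) \<in> ordLeq"
  by (auto simp: lepoll_def card_of_ordLeq[symmetric])

lemma times_lepoll_infinite:
  assumes "infinite C" "A \<lesssim> C" "B \<lesssim> C"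
  shows "A \<times> B \<lesssim> C"
proof -
  have "A \<times> B \<lesssim> C \<times> C" by (rule times_lepoll_mono) (use assms in auto)
  also have "C \<times> C \<approx> C"
    unfolding eqpoll_iff_card_of_ordIso by (rule card_of_Times_same_infinite) fact
  finally show ?thesis .
qed

lemma UN_lepoll_infinite:
  assumes "infinite C" "I \<lesssim> C" "\<And>i. i \<in> I \<Longrightarrow> A i \<lesssim> C"
  shows "(\<Union>i\<in>I. A i) \<lesssim> C"
  using card_of_UNION_ordLeq_infinite[of C I A] assms by (auto simp: lepoll_iff_card_of)

lemma Un_lepoll_infinite:
  assumes "infinite C" "A \<lesssim> C" "B \<lesssim> C"
  shows "A \<union> B \<lesssim> C"
proof -
  have "(\<Union>b\<in>{True, False}. if b then A else B) \<lesssim> C"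
    by (rule UN_lepoll_infinite) (use assms in \<open>auto simp: finite_lepoll_infinite\<close>)
  then show ?thesis by (simp add: Un_commute)
qed

lemma lists_lepoll_infinite:
  assumes "infinite A"
  shows "lists A \<lesssim> A"
proof -
  have len: "{xs \<in> lists A. length xs = n} \<lesssim> A" for n
  proof (induction n)
    case 0
    have "{xs \<in> lists A. length xs = 0} \<subseteq> {[]}" by auto
    then show ?case using assms by (meson finite.emptyI finite_insert finite_lepoll_infinite finite_subset)
  next
    case (Suc n)
    have "{xs \<in> lists A. length xs = Suc n} \<subseteq> (\<lambda>(x, xs). x # xs) ` (A \<times> {xs \<in> lists A. length xs = n})"
      by (auto simp: length_Suc_conv image_iff)
    then have "{xs \<in> lists A. length xs = Suc n} \<lesssim> A \<times> {xs \<in> lists A. length xs = n}"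
      by (rule subset_image_lepoll)
    also have "\<dots> \<lesssim> A" using assms Suc by (intro times_lepoll_infinite) auto
    finally show ?case .
  qed
  have "lists A = (\<Union>n\<in>UNIV. {xs \<in> lists A. length xs = n})" by auto
  also have "\<dots> \<lesssim> A" using assms len by (intro UN_lepoll_infinite) (simp_all add: infinite_le_lepoll)
  finally show ?thesis .
qed

section \<open>Cardinals, clubs and coherence, with \<open>{..<\<alpha>}\<close> in the role of the
  ordinal \<alpha>\<close>

definition is_card :: "'a::wellorder \<Rightarrow> bool" where
  "is_card \<kappa> \<longleftrightarrow> (\<forall>\<alpha><\<kappa>. \<not> {..<\<alpha>} \<approx> {..<\<kappa>})"

definition club_in :: "'a::wellorder \<Rightarrow> 'a set \<Rightarrow> bool" where
  "club_in \<delta> C \<longleftrightarrow> C \<subseteq> {..<\<delta>} \<and> (\<forall>\<alpha><\<delta>. \<exists>\<beta>\<in>C. \<alpha> < \<beta>) \<and>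
    (\<forall>\<mu><\<delta>. (\<exists>\<xi>. \<xi> < \<mu>) \<and> (\<forall>\<xi><\<mu>. \<exists>\<beta>\<in>C. \<xi> < \<beta> \<and> \<beta> < \<mu>) \<longrightarrow> \<mu> \<in> C)"

definition coherent_below :: "'a::wellorder \<Rightarrow> bool" where
  "coherent_below \<delta> \<longleftrightarrow> (\<forall>E C. (\<forall>\<gamma><\<delta>. E \<gamma> \<subseteq> {..<\<gamma>}) \<and> club_in \<delta> C \<longrightarrow>
    (\<exists>\<beta>\<in>C. \<exists>\<gamma>\<in>C. \<beta> < \<gamma> \<and> E \<beta> = E \<gamma> \<inter> {..<\<beta>}))"

lemma lepoll_lessThan_mono: "\<alpha> \<le> \<beta> \<Longrightarrow> {..<\<alpha>::'a::wellorder} \<lesssim> {..<\<beta>}"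
  by (rule subset_imp_lepoll) auto

lemma le_strict_mono_below:
  fixes \<psi> :: "'a::wellorder \<Rightarrow> 'a"
  assumes mono: "\<And>a b. a < b \<Longrightarrow> b < \<gamma> \<Longrightarrow> \<psi> a < \<psi> b" and "b < \<gamma>"
  shows "b \<le> \<psi> b"
  using \<open>b < \<gamma>\<close>
proof (induction b rule: less_induct)
  case (less b)
  show ?case
  proof (rule ccontr)
    assume "\<not> b \<le> \<psi> b"
    then have *: "\<psi> b < b" by simp
    then have "\<psi> b \<le> \<psi> (\<psi> b)" using less by (meson less_trans)
    with mono[OF * less.prems] show False by simp
  qed
qed

lemma is_card_limit:
  assumes "\<And>\<xi>. \<xi> < \<mu> \<Longrightarrow> \<exists>\<kappa>. \<xi> < \<kappa> \<and> \<kappa> \<le> \<mu> \<and> is_card \<kappa>"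
  shows "is_card \<mu>"
  unfolding is_card_def
proof (intro allI impI notI)
  fix \<alpha> assume "\<alpha> < \<mu>" and eq: "{..<\<alpha>} \<approx> {..<\<mu>}"
  then obtain \<kappa> where \<kappa>: "\<alpha> < \<kappa>" "\<kappa> \<le> \<mu>" "is_card \<kappa>" using assms by blast
  have "{..<\<kappa>} \<lesssim> {..<\<alpha>}"
    using lepoll_lessThan_mono[OF \<kappa>(2)] eq by (meson eqpoll_sym lepoll_trans2)
  moreover have "{..<\<alpha>} \<lesssim> {..<\<kappa>}" using \<kappa> by (intro lepoll_lessThan_mono) auto
  ultimately have "{..<\<alpha>} \<approx> {..<\<kappa>}" by (intro lepoll_antisym)
  then show False using \<kappa> by (auto simp: is_card_def)
qed

text \<open>If all these segments were finite, their sizes would inject \<open>{..<\<delta>}\<close>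
  into the naturals.\<close>

lemma infinite_below_uncountable:
  assumes "uncountable {..<\<delta>::'a::wellorder}"
  shows "\<exists>w<\<delta>. infinite {..<w}"
proof (rule ccontr)
  assume "\<not> ?thesis"
  then have fin: "finite {..<w}" if "w < \<delta>" for w using that by blast
  have "inj_on (\<lambda>w. card {..<w}) {..<\<delta>}"
  proof (rule linorder_inj_onI)
    fix a b assume "a < b" "a \<in> {..<\<delta>}" "b \<in> {..<\<delta>}"
    then have "card {..<a} < card {..<b}" using fin[of b] by (intro psubset_card_mono) auto
    then show "card {..<a} \<noteq> card {..<b}" by simp
  qed auto
  then show False using assms countableI by blast
qed

lemma is_card_unbounded:
  assumes "is_card \<delta>" "infinite {..<\<delta>}" "\<alpha> < \<delta>"
  shows "\<exists>\<beta>. \<alpha> < \<beta> \<and> \<beta> < \<delta>"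
proof (rule ccontr)
  assume "\<not> ?thesis"
  then have eq: "{..<\<delta>} = insert \<alpha> {..<\<alpha>}" using \<open>\<alpha> < \<delta>\<close> by (auto simp: not_less) (meson le_less not_le)
  then have "infinite {..<\<alpha>}" using assms(2) by simp
  then have "{..<\<alpha>} \<approx> {..<\<delta>}" unfolding eq by (rule infinite_insert_eqpoll[THEN eqpoll_sym])
  then show False using assms by (auto simp: is_card_def)
qed

section \<open>Consequences of subtlety: regularity, cardinals below \<delta> and closure
  points\<close>

locale uncountable_subtle =
  fixes \<delta> :: "'a::wellorder"
  assumes card: "is_card \<delta>" and unc: "uncountable {..<\<delta>}" and coh: "coherent_below \<delta>"
begin

lemma inf: "infinite {..<\<delta>}"
  using unc countable_finite by blast

lemma unbounded: "\<alpha> < \<delta> \<Longrightarrow> \<exists>\<beta>. \<alpha> < \<beta> \<and> \<beta> < \<delta>"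
  using is_card_unbounded card inf by blast

lemma coherent:
  assumes "\<And>\<gamma>. \<gamma> < \<delta> \<Longrightarrow> E \<gamma> \<subseteq> {..<\<gamma>}" "club_in \<delta> C"
  obtains \<beta> \<gamma> where "\<beta> \<in> C" "\<gamma> \<in> C" "\<beta> < \<gamma>" "E \<beta> = E \<gamma> \<inter> {..<\<beta>}"
  using coh assms unfolding coherent_below_def by blast

lemma club_in_greaterThan:
  assumes "\<alpha> < \<delta>"
  shows "club_in \<delta> {\<alpha><..<\<delta>}"
  unfolding club_in_def
proof (intro conjI allI impI)
  fix \<xi> assume "\<xi> < \<delta>"
  then show "\<exists>\<beta>\<in>{\<alpha><..<\<delta>}. \<xi> < \<beta>" using unbounded[of "max \<alpha> \<xi>"] assms by auto
next
  fix \<mu> assume "\<mu> < \<delta>" "(\<exists>\<xi>. \<xi> < \<mu>) \<and> (\<forall>\<xi><\<mu>. \<exists>\<beta>\<in>{\<alpha><..<\<delta>}. \<xi> < \<beta> \<and> \<beta> < \<mu>)"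
  then obtain \<beta> where "\<alpha> < \<beta>" "\<beta> < \<mu>" by (meson greaterThanLessThan_iff)
  then show "\<mu> \<in> {\<alpha><..<\<delta>}" using \<open>\<mu> < \<delta>\<close> by simp
qed auto

text \<open>
  If \<open>S\<close> were unbounded, record at each \<open>\<gamma>\<close> in the closure of \<open>S\<close> the indices of the
  elements of \<open>S\<close> up to \<open>\<gamma>\<close>: no two of these sets cohere.
\<close>

lemma regular:
  assumes S: "S \<subseteq> {..<\<delta>}" "S \<lesssim> {..<\<theta>}" and "\<theta> < \<delta>"
  shows "\<exists>\<beta><\<delta>. \<forall>s\<in>S. s < \<beta>"
proof (rule ccontr)
  assume "\<not> ?thesis"
  then have unb: "\<exists>s\<in>S. \<beta> \<le> s" if "\<beta> < \<delta>" for \<beta> using that by (meson not_le)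
  obtain i where i: "inj_on i S" "i ` S \<subseteq> {..<\<theta>}" using S(2) by (auto simp: lepoll_def)
  define C where "C = {\<gamma>. \<gamma> < \<delta> \<and> \<theta> < \<gamma> \<and> (\<gamma> \<in> S \<or> (\<forall>\<xi><\<gamma>. \<exists>s\<in>S. \<xi> < s \<and> s < \<gamma>))}"
  define E where "E \<gamma> = (if \<theta> < \<gamma> then i ` {s \<in> S. s \<le> \<gamma>} else {})" for \<gamma>
  have "E \<gamma> \<subseteq> {..<\<gamma>}" for \<gamma> using i by (auto simp: E_def)
  moreover have "club_in \<delta> C"
    unfolding club_in_def
  proof (intro conjI allI impI)
    show "C \<subseteq> {..<\<delta>}" by (auto simp: C_def)
    fix \<alpha> assume "\<alpha> < \<delta>"
    then obtain \<beta> where "max \<alpha> \<theta> < \<beta>" "\<beta> < \<delta>" using unbounded[of "max \<alpha> \<theta>"] \<open>\<theta> < \<delta>\<close> by auto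
    then obtain s where "s \<in> S" "\<beta> \<le> s" using unb by blast
    then have "max \<alpha> \<theta> < s" using \<open>max \<alpha> \<theta> < \<beta>\<close> by order
    then show "\<exists>\<beta>\<in>C. \<alpha> < \<beta>" using S(1) \<open>s \<in> S\<close> by (intro bexI[of _ s]) (auto simp: C_def)
  next
    fix \<mu> assume "\<mu> < \<delta>" and *: "(\<exists>\<xi>. \<xi> < \<mu>) \<and> (\<forall>\<xi><\<mu>. \<exists>\<beta>\<in>C. \<xi> < \<beta> \<and> \<beta> < \<mu>)"
    then obtain \<beta> where "\<beta> \<in> C" "\<beta> < \<mu>" by blast
    then have "\<theta> < \<mu>" using less_trans by (simp add: C_def) blast
    moreover have "\<exists>s\<in>S. \<xi> < s \<and> s < \<mu>" if "\<xi> < \<mu>" for \<xi>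
    proof -
      have "\<exists>\<beta>\<in>C. \<xi> < \<beta> \<and> \<beta> < \<mu>" using * that by simp
      then obtain \<beta> where \<beta>: "\<beta> \<in> C" "\<xi> < \<beta>" "\<beta> < \<mu>" by blast
      show ?thesis
      proof (cases "\<beta> \<in> S")
        case True
        then show ?thesis using \<beta> by blast
      next
        case False
        then have "\<exists>s\<in>S. \<xi> < s \<and> s < \<beta>" using \<beta>(1,2) by (simp add: C_def)
        then show ?thesis using \<beta>(3) by (meson less_trans)
      qed
    qed
    ultimately show "\<mu> \<in> C" using \<open>\<mu> < \<delta>\<close> by (simp add: C_def)
  qed
  ultimately obtain \<beta> \<gamma> where bg: "\<beta> \<in> C" "\<gamma> \<in> C" "\<beta> < \<gamma>" "E \<beta> = E \<gamma> \<inter> {..<\<beta>}"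
    by (rule coherent)
  have \<theta>: "\<theta> < \<beta>" "\<theta> < \<gamma>" using bg(1,2) by (simp_all add: C_def)
  \<comment> \<open>Some \<open>s\<close> in \<open>S\<close> is above \<beta> and at most \<gamma>.
    Its index is below \<theta>, hence below \<beta>, so coherence puts the index into
    \<open>E \<beta>\<close>, which only records elements up to \<beta>.\<close>
  have "\<gamma> \<in> S \<or> (\<exists>s\<in>S. \<beta> < s \<and> s < \<gamma>)" using bg(2,3) by (simp add: C_def) blast
  then obtain s where s: "s \<in> S" "\<beta> < s" "s \<le> \<gamma>" using bg(3) less_imp_le by blast
  moreover have "i s < \<beta>" using \<open>s \<in> S\<close> i(2) \<theta> by force
  ultimately have "i s \<in> E \<gamma> \<inter> {..<\<beta>}" using \<theta> by (simp add: E_def)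
  then have "i s \<in> i ` {s \<in> S. s \<le> \<beta>}" using bg by (auto simp: E_def split: if_splits)
  then show False using s i(1) by (auto simp: inj_on_eq_iff)
qed

text \<open>
  If all \<open>\<gamma> < \<delta>\<close> inject into \<open>\<theta>\<close>, then subsets of \<open>\<theta>\<close> coding well-orders of type \<open>\<gamma>\<close>
  never cohere.
\<close>

lemma ex_card:
  assumes "\<xi> < \<delta>"
  shows "\<exists>\<kappa>. \<xi> < \<kappa> \<and> \<kappa> < \<delta> \<and> infinite {..<\<kappa>} \<and> is_card \<kappa>"
proof -
  obtain w where w: "w < \<delta>" "infinite {..<w}" using infinite_below_uncountable unc by blast
  define \<theta> where "\<theta> = max \<xi> w"
  have \<theta>: "\<theta> < \<delta>" "infinite {..<\<theta>}"
    using w assms infinite_super[of "{..<w}" "{..<\<theta>}"] by (auto simp: \<theta>_def)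
  have "\<exists>\<gamma><\<delta>. \<not> {..<\<gamma>} \<lesssim> {..<\<theta>}"
  proof (rule ccontr)
    assume "\<not> ?thesis"
    then have "\<forall>\<gamma>\<in>{..<\<delta>}. \<exists>f. inj_on f {..<\<gamma>} \<and> f ` {..<\<gamma>} \<subseteq> {..<\<theta>}" by (auto simp: lepoll_def)
    then obtain f where f: "\<And>\<gamma>. \<gamma> < \<delta> \<Longrightarrow> inj_on (f \<gamma>) {..<\<gamma>}" "\<And>\<gamma>. \<gamma> < \<delta> \<Longrightarrow> f \<gamma> ` {..<\<gamma>} \<subseteq> {..<\<theta>}"
      by (metis lessThan_iff)
    obtain p where p: "inj_on p ({..<\<theta>} \<times> {..<\<theta>})" "p ` ({..<\<theta>} \<times> {..<\<theta>}) \<subseteq> {..<\<theta>}"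
      using times_lepoll_infinite[OF \<theta>(2) lepoll_refl lepoll_refl] by (auto simp: lepoll_def)
    \<comment> \<open>\<open>R \<gamma>\<close> is the well-order of type \<gamma> that
      \<open>f \<gamma>\<close> induces on its image in \<theta>. As \<open>p\<close> codes it by a
      subset of \<theta>, coherence above \<theta> amounts to equality.\<close>
    define R where "R \<gamma> = {(f \<gamma> a, f \<gamma> b) | a b. a \<le> b \<and> b < \<gamma>}" for \<gamma>
    have R_sub: "R \<gamma> \<subseteq> {..<\<theta>} \<times> {..<\<theta>}" if "\<gamma> < \<delta>" for \<gamma> using f(2)[OF that] by (fastforce simp: R_def)
    define E where "E \<gamma> = (if \<theta> < \<gamma> then p ` R \<gamma> else {})" for \<gamma>
    have E\<theta>: "E \<gamma> \<subseteq> {..<\<theta>}" if "\<gamma> < \<delta>" for \<gamma> using p(2) R_sub[OF that] by (auto simp: E_def)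
    have "E \<gamma> \<subseteq> {..<\<gamma>}" if "\<gamma> < \<delta>" for \<gamma> using E\<theta>[OF that] by (auto simp: E_def split: if_splits)
    then obtain \<beta> \<gamma> where bg: "\<beta> \<in> {\<theta><..<\<delta>}" "\<gamma> \<in> {\<theta><..<\<delta>}" "\<beta> < \<gamma>" "E \<beta> = E \<gamma> \<inter> {..<\<beta>}"
      using club_in_greaterThan[OF \<theta>(1)] by (rule coherent)
    then have "E \<beta> = E \<gamma>" using E\<theta>[of \<gamma>] by auto
    then have "R \<beta> = R \<gamma>" using bg inj_on_image_eq_iff[OF p(1) R_sub R_sub, of \<beta> \<gamma>] by (auto simp: E_def)
    have fR: "(f \<gamma> a, f \<gamma> b) \<in> R \<gamma> \<longleftrightarrow> a \<le> b" if "a < \<gamma>" "b < \<gamma>" "\<gamma> < \<delta>" for a b \<gamma>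
    proof
      assume "(f \<gamma> a, f \<gamma> b) \<in> R \<gamma>"
      then obtain a' b' where ab: "f \<gamma> a = f \<gamma> a'" "f \<gamma> b = f \<gamma> b'" "a' \<le> b'" "b' < \<gamma>"
        unfolding R_def by blast
      then have "a' < \<gamma>" by order
      then show "a \<le> b" using ab that f(1)[OF that(3)] inj_onD by (metis lessThan_iff)
    qed (use that in \<open>auto simp: R_def\<close>)
    have "f \<gamma> ` {..<\<gamma>} \<subseteq> f \<beta> ` {..<\<beta>}"
    proof
      fix x assume "x \<in> f \<gamma> ` {..<\<gamma>}"
      then have "(x, x) \<in> R \<beta>" unfolding \<open>R \<beta> = R \<gamma>\<close> by (auto simp: R_def)
      then show "x \<in> f \<beta> ` {..<\<beta>}" by (auto simp: R_def)
    qed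
    then have "\<forall>a\<in>{..<\<gamma>}. \<exists>b. b < \<beta> \<and> f \<beta> b = f \<gamma> a" by force
    \<comment> \<open>\<psi> is \<open>f \<gamma>\<close> followed by the inverse of
      \<open>f \<beta>\<close>. It would embed \<gamma> into the smaller \<beta> in an
      order-preserving way.\<close>
    from bchoice[OF this] obtain \<psi>
      where \<psi>: "\<And>a. a < \<gamma> \<Longrightarrow> \<psi> a < \<beta>" "\<And>a. a < \<gamma> \<Longrightarrow> f \<beta> (\<psi> a) = f \<gamma> a" by auto
    have "\<psi> a < \<psi> b" if "a < b" "b < \<gamma>" for a b
    proof -
      have "\<not> b \<le> a" "a < \<gamma>" using that by auto
      then have "(f \<gamma> b, f \<gamma> a) \<notin> R \<gamma>" using fR that bg by auto
      then have "(f \<beta> (\<psi> b), f \<beta> (\<psi> a)) \<notin> R \<beta>" using \<psi>(2) \<open>a < \<gamma>\<close> that \<open>R \<beta> = R \<gamma>\<close> by simp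
      then show ?thesis using fR[where \<gamma>=\<beta> and a="\<psi> b" and b="\<psi> a"] \<psi>(1) \<open>a < \<gamma>\<close> that bg by auto
    qed
    then have "\<beta> \<le> \<psi> \<beta>" using bg by (intro le_strict_mono_below[of \<gamma>]) auto
    then show False using \<psi>(1)[of \<beta>] bg by auto
  qed
  then obtain \<gamma> where \<gamma>: "\<gamma> < \<delta> \<and> \<not> {..<\<gamma>} \<lesssim> {..<\<theta>}" (is "?P \<gamma>") by blast
  \<comment> \<open>The cardinal successor of \<theta>.\<close>
  define \<kappa> where "\<kappa> = (LEAST \<gamma>. ?P \<gamma>)"
  have \<kappa>: "\<kappa> < \<delta>" "\<not> {..<\<kappa>} \<lesssim> {..<\<theta>}" using LeastI[of ?P, OF \<gamma>] by (auto simp: \<kappa>_def)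
  have least: "{..<\<alpha>} \<lesssim> {..<\<theta>}" if "\<alpha> < \<kappa>" for \<alpha>
    using not_less_Least[OF that[unfolded \<kappa>_def]] that \<kappa>(1) by (meson less_trans)
  have "is_card \<kappa>" unfolding is_card_def using least \<kappa>(2) by (meson eqpoll_sym lepoll_trans1)
  moreover have "\<theta> < \<kappa>" using \<kappa>(2) lepoll_lessThan_mono[of \<kappa> \<theta>] by (meson not_le)
  moreover have "infinite {..<\<kappa>}" using \<kappa>(2) \<theta>(2) by (meson finite_lepoll_infinite)
  ultimately show ?thesis using \<kappa>(1) by (auto simp: \<theta>_def)
qed

text \<open>Iterating a bound \<open>B\<close> for \<open>f\<close> countably often from any point
  and taking the supremum gives a closure point; by regularity it stays below \<delta>.\<close>

lemma club_in_closure_points: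
  assumes f: "\<And>\<alpha>. \<alpha> < \<delta> \<Longrightarrow> f \<alpha> < \<delta>" and "\<alpha>\<^sub>0 < \<delta>"
  shows "club_in \<delta> {\<mu>. \<mu> < \<delta> \<and> \<alpha>\<^sub>0 < \<mu> \<and> (\<forall>\<alpha><\<mu>. f \<alpha> < \<mu>)}" (is "club_in \<delta> ?C")
  unfolding club_in_def
proof (intro conjI allI impI)
  show "?C \<subseteq> {..<\<delta>}" by auto
  fix \<alpha> assume "\<alpha> < \<delta>"
  have "\<exists>b. a < b \<and> b < \<delta> \<and> (\<forall>x\<le>a. f x < b)" if "a < \<delta>" for a
  proof -
    obtain a' where a': "a < a'" "a' < \<delta>" using unbounded \<open>a < \<delta>\<close> by blast
    have "f ` {..a} \<lesssim> {..<a'}" using a'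
      by (meson image_lepoll lepoll_trans subset_imp_lepoll atMost_subset_iff subsetI atMost_iff lessThan_iff le_less_trans)
    moreover have "f ` {..a} \<subseteq> {..<\<delta>}" using f \<open>a < \<delta>\<close> by (auto intro: le_less_trans)
    ultimately obtain b where "b < \<delta>" "\<forall>x\<in>f ` {..a}. x < b"
      using regular[of "f ` {..a}" a'] a'(2) by blast
    then show ?thesis using a' by (intro exI[of _ "max a' b"]) (auto simp: less_max_iff_disj)
  qed
  then obtain B where B: "\<And>a. a < \<delta> \<Longrightarrow> a < B a" "\<And>a. a < \<delta> \<Longrightarrow> B a < \<delta>"
    "\<And>a x. a < \<delta> \<Longrightarrow> x \<le> a \<Longrightarrow> f x < B a" by metis
  define c where "c n = (B ^^ n) (max \<alpha> \<alpha>\<^sub>0)" for n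
  have c_Suc: "c (Suc n) = B (c n)" for n by (simp add: c_def)
  have c_less: "c n < \<delta>" for n
  proof (induction n)
    case 0
    then show ?case using \<open>\<alpha> < \<delta>\<close> \<open>\<alpha>\<^sub>0 < \<delta>\<close> by (simp add: c_def)
  next
    case (Suc n)
    then show ?case using B(2) by (simp add: c_Suc)
  qed
  obtain w where w: "w < \<delta>" "infinite {..<w}" using infinite_below_uncountable unc by blast
  have "range c \<lesssim> {..<w}" using w(2) by (meson image_lepoll infinite_le_lepoll lepoll_trans)
  then obtain \<beta> where \<beta>: "\<beta> < \<delta>" "\<And>n. c n < \<beta>" using regular[of "range c" w] w c_less by auto
  define \<mu> where "\<mu> = (LEAST \<mu>. \<forall>n. c n < \<mu>)"
  have c_\<mu>: "c n < \<mu>" for n using LeastI[of "\<lambda>\<mu>. \<forall>n. c n < \<mu>" \<beta>] \<beta> by (auto simp: \<mu>_def)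
  have "\<mu> \<le> \<beta>" unfolding \<mu>_def using \<beta> by (intro Least_le) auto
  have "f x < \<mu>" if "x < \<mu>" for x
  proof -
    have "\<exists>n. x \<le> c n" using that not_less_Least[of x "\<lambda>\<mu>. \<forall>n. c n < \<mu>"] by (auto simp: \<mu>_def not_less)
    then obtain n where "x \<le> c n" by blast
    then have "f x < c (Suc n)" using B(3) c_less c_Suc by simp
    then show ?thesis using c_\<mu> by (rule less_trans)
  qed
  then show "\<exists>\<beta>\<in>?C. \<alpha> < \<beta>" using \<open>\<mu> \<le> \<beta>\<close> \<beta>(1) c_\<mu>[of 0]
    by (intro bexI[of _ \<mu>]) (auto simp: c_def)
next
  fix \<mu> assume "\<mu> < \<delta>" "(\<exists>\<xi>. \<xi> < \<mu>) \<and> (\<forall>\<xi><\<mu>. \<exists>\<beta>\<in>?C. \<xi> < \<beta> \<and> \<beta> < \<mu>)"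
  then show "\<mu> \<in> ?C" by auto (meson less_trans)+
qed

text \<open>The injection \<open>i\<close> turns sets of finite tagged lists into sets of ordinals.
  At closure points of a function bounding \<open>i\<close>, \<open>r\<close> and a larger cardinal,
  lists below \<beta> have codes below \<beta>, so coherence of the codes yields the
  inclusion.\<close>

lemma ex_reflecting_pair:
  fixes \<Phi> :: "'a \<Rightarrow> (nat \<times> 'a list) set"
  assumes \<Phi>: "\<And>\<kappa>. \<kappa> < \<delta> \<Longrightarrow> \<Phi> \<kappa> \<subseteq> UNIV \<times> lists {..<\<kappa>}"
    and r: "\<And>\<alpha>. \<alpha> < \<delta> \<Longrightarrow> r \<alpha> < \<delta>" and "\<alpha>\<^sub>0 < \<delta>"
  obtains \<kappa> \<mu> where "\<alpha>\<^sub>0 < \<kappa>" "\<kappa> < \<mu>" "\<mu> < \<delta>" "is_card \<kappa>" "infinite {..<\<kappa>}"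
    "is_card \<mu>" "infinite {..<\<mu>}" "r \<kappa> < \<mu>" "\<Phi> \<kappa> \<subseteq> \<Phi> \<mu>"
proof -
  have "(UNIV :: nat set) \<times> lists {..<\<delta>} \<lesssim> {..<\<delta>}"
    by (intro times_lepoll_infinite lists_lepoll_infinite inf) (use inf infinite_le_lepoll in blast)
  then obtain i where i: "inj_on i ((UNIV :: nat set) \<times> lists {..<\<delta>})"
    "i ` ((UNIV :: nat set) \<times> lists {..<\<delta>}) \<subseteq> {..<\<delta>}" by (auto simp: lepoll_def)
  define Q where "Q \<alpha> b \<longleftrightarrow> b < \<delta> \<and> r \<alpha> \<le> b \<and> (\<exists>\<kappa>\<le>b. \<alpha> < \<kappa> \<and> infinite {..<\<kappa>} \<and> is_card \<kappa>) \<and>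
    (\<forall>x\<in>UNIV \<times> lists {..\<alpha>}. i x \<le> b)" for \<alpha> b
  have "\<exists>b. Q \<alpha> b" if "\<alpha> < \<delta>" for \<alpha>
  proof -
    obtain \<kappa> where \<kappa>: "\<alpha> < \<kappa>" "\<kappa> < \<delta>" "infinite {..<\<kappa>}" "is_card \<kappa>" using ex_card \<open>\<alpha> < \<delta>\<close> by blast
    let ?U = "(UNIV :: nat set) \<times> lists {..\<alpha>}"
    have "?U \<subseteq> UNIV \<times> lists {..<\<kappa>}" using \<kappa>(1) by auto
    then have "i ` ?U \<lesssim> (UNIV :: nat set) \<times> lists {..<\<kappa>}"
      by (intro lepoll_trans[OF image_lepoll] subset_imp_lepoll)
    also have "(UNIV :: nat set) \<times> lists {..<\<kappa>} \<lesssim> {..<\<kappa>}"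
      by (intro times_lepoll_infinite lists_lepoll_infinite \<kappa>) (use \<kappa> infinite_le_lepoll in blast)
    finally have "i ` ?U \<lesssim> {..<\<kappa>}" .
    moreover have "?U \<subseteq> UNIV \<times> lists {..<\<delta>}" using \<open>\<alpha> < \<delta>\<close> by auto
    then have "i ` ?U \<subseteq> {..<\<delta>}" using i(2) by (meson image_mono subset_trans)
    ultimately obtain b where b: "b < \<delta>" "\<forall>x\<in>i ` ?U. x < b"
      using regular[of "i ` ?U" \<kappa>] \<kappa>(2) by blast
    have "Q \<alpha> (max (r \<alpha>) (max \<kappa> b))"
      unfolding Q_def
    proof (intro conjI ballI)
      show "\<exists>\<kappa>'\<le>max (r \<alpha>) (max \<kappa> b). \<alpha> < \<kappa>' \<and> infinite {..<\<kappa>'} \<and> is_card \<kappa>'"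
        using \<kappa> by (intro exI[of _ \<kappa>]) (simp add: le_max_iff_disj)
      fix x assume "x \<in> ?U"
      then have "i x < b" using b(2) by blast
      then show "i x \<le> max (r \<alpha>) (max \<kappa> b)" by (simp add: le_max_iff_disj less_imp_le)
    qed (use b \<kappa> r[OF \<open>\<alpha> < \<delta>\<close>] in simp_all)
    then show ?thesis ..
  qed
  then have "\<forall>\<alpha>\<in>{..<\<delta>}. \<exists>b. Q \<alpha> b" by simp
  from bchoice[OF this] obtain f where "\<And>\<alpha>. \<alpha> < \<delta> \<Longrightarrow> Q \<alpha> (f \<alpha>)" by auto
  then have f: "\<And>\<alpha>. \<alpha> < \<delta> \<Longrightarrow> f \<alpha> < \<delta>" "\<And>\<alpha>. \<alpha> < \<delta> \<Longrightarrow> r \<alpha> \<le> f \<alpha>"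
    "\<And>\<alpha>. \<alpha> < \<delta> \<Longrightarrow> \<exists>\<kappa>\<le>f \<alpha>. \<alpha> < \<kappa> \<and> infinite {..<\<kappa>} \<and> is_card \<kappa>"
    "\<And>\<alpha> n xs. \<alpha> < \<delta> \<Longrightarrow> xs \<in> lists {..\<alpha>} \<Longrightarrow> i (n, xs) \<le> f \<alpha>"
    unfolding Q_def by simp_all
  define C where "C = {\<mu>. \<mu> < \<delta> \<and> \<alpha>\<^sub>0 < \<mu> \<and> (\<forall>\<alpha><\<mu>. f \<alpha> < \<mu>)}"
  have C: "club_in \<delta> C" unfolding C_def using f(1) \<open>\<alpha>\<^sub>0 < \<delta>\<close> by (rule club_in_closure_points)
  define E where "E \<kappa> = i ` \<Phi> \<kappa> \<inter> {..<\<kappa>}" for \<kappa>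
  obtain \<beta> \<gamma> where bg: "\<beta> \<in> C" "\<gamma> \<in> C" "\<beta> < \<gamma>" "E \<beta> = E \<gamma> \<inter> {..<\<beta>}"
    using coherent[of E C] C by (auto simp: E_def)
  have CC: "is_card \<mu> \<and> infinite {..<\<mu>} \<and> \<mu> < \<delta> \<and> \<alpha>\<^sub>0 < \<mu>" if "\<mu> \<in> C" for \<mu>
  proof -
    have \<mu>: "\<mu> < \<delta>" "\<alpha>\<^sub>0 < \<mu>" "\<And>\<alpha>. \<alpha> < \<mu> \<Longrightarrow> f \<alpha> < \<mu>" using that by (auto simp: C_def)
    have ex: "\<exists>\<kappa>. \<xi> < \<kappa> \<and> \<kappa> \<le> \<mu> \<and> is_card \<kappa> \<and> infinite {..<\<kappa>}" if "\<xi> < \<mu>" for \<xi>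
      using f(3)[of \<xi>] \<mu> that by (meson less_trans order.strict_implies_order order.trans)
    then have "is_card \<mu>" by (intro is_card_limit) blast
    moreover have "infinite {..<\<mu>}" using ex[OF \<mu>(2)] by (meson infinite_super lessThan_subset_iff)
    ultimately show ?thesis using \<mu> by blast
  qed
  \<comment> \<open>A nonempty finite list below \<beta> has a maximum \<alpha> < \<beta>, and
    \<open>f \<alpha>\<close> bounds its code; \<open>\<alpha>\<^sub>0\<close> serves for the empty
    list.\<close>
  have closed: "i (n, xs) < \<beta>" if "xs \<in> lists {..<\<beta>}" for n xs
  proof -
    obtain \<alpha> where "\<alpha> < \<beta>" "xs \<in> lists {..\<alpha>}"
    proof (cases "xs = []")
      case True
      then show ?thesis using that[of \<alpha>\<^sub>0] CC[OF bg(1)] by auto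
    next
      case False
      then show ?thesis using \<open>xs \<in> lists {..<\<beta>}\<close> by (intro that[of "Max (set xs)"]) auto
    qed
    then have "i (n, xs) \<le> f \<alpha>" using f(4) CC[OF bg(1)] by (meson less_trans)
    also have "f \<alpha> < \<beta>" using bg(1) \<open>\<alpha> < \<beta>\<close> by (auto simp: C_def)
    finally show ?thesis .
  qed
  have "\<Phi> \<beta> \<subseteq> \<Phi> \<gamma>"
  proof
    fix x assume x: "x \<in> \<Phi> \<beta>"
    then have x': "x \<in> UNIV \<times> lists {..<\<beta>}" using \<Phi> CC[OF bg(1)] by blast
    then have "i x \<in> E \<beta>" using x closed by (auto simp: E_def)
    then have "i x \<in> i ` \<Phi> \<gamma>" using bg(4) by (auto simp: E_def)
    moreover have "x \<in> UNIV \<times> lists {..<\<delta>}" using x' CC[OF bg(1)] by auto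
    moreover have "\<Phi> \<gamma> \<subseteq> UNIV \<times> lists {..<\<delta>}" using \<Phi> CC[OF bg(2)] by fastforce
    ultimately show "x \<in> \<Phi> \<gamma>" using i(1) by (meson inj_on_image_mem_iff)
  qed
  moreover have "r \<beta> < \<gamma>" using f(2)[of \<beta>] bg CC[OF bg(1)] by (auto simp: C_def)
  ultimately show ?thesis using that[of \<beta> \<gamma>] bg CC by blast
qed

end

section \<open>The combinatorial core of the failure of reflection\<close>

text \<open>A homomorphism preserves relations but need not reflect them, so membership in
  \<open>E\<close> and its negation have separate symbols.\<close>

datatype sym = Top | Le | Less | LessG | InD | GapG | Zero | InEG | NotInEG
  | InE | NotInE | NoneBetween | LeMin | LadderG nat

instance sym :: countable by countable_datatype

text \<open>For ordinals such a sequence exists exactly when \<mu> is a nonzero limit of countable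
  cofinality.\<close>

definition cofinal_seq :: "(nat \<Rightarrow> 'a::linorder) \<Rightarrow> 'a \<Rightarrow> bool" where
  "cofinal_seq f \<mu> \<longleftrightarrow> (\<forall>n. f n < \<mu>) \<and> (\<forall>\<xi><\<mu>. \<exists>n. \<xi> < f n)"

definition ladder :: "'a::linorder \<Rightarrow> nat \<Rightarrow> 'a" where
  "ladder \<mu> = (SOME f. cofinal_seq f \<mu>)"

lemma cofinal_seq_ladder: "cofinal_seq f \<mu> \<Longrightarrow> cofinal_seq (ladder \<mu>) \<mu>"
  unfolding ladder_def by (rule someI[of "\<lambda>f. cofinal_seq f \<mu>"])

text \<open>
  The ordinal \<open>\<alpha>\<close> is represented in the product by \<open>\<beta> \<mapsto> min \<alpha> \<beta>\<close>. The disjuncts \<open>a = \<gamma>\<close> and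
  \<open>b = \<gamma>\<close> (names ending in \<open>G\<close>) make a relation hold at the coordinates where this truncation
  is effective. All relations have arity 5, with unused arguments.
\<close>

fun interp :: "'a::wellorder set \<Rightarrow> ('a \<Rightarrow> 'a set) \<Rightarrow> 'a \<Rightarrow> sym \<Rightarrow> 'a \<Rightarrow> 'a \<Rightarrow> 'a \<Rightarrow> 'a \<Rightarrow> 'a \<Rightarrow> bool"
where
  "interp D E \<gamma> Top a b c d e \<longleftrightarrow> a = \<gamma>"
| "interp D E \<gamma> Le a b c d e \<longleftrightarrow> a \<le> b"
| "interp D E \<gamma> Less a b c d e \<longleftrightarrow> a < b"
| "interp D E \<gamma> LessG a b c d e \<longleftrightarrow> a = \<gamma> \<or> a < b"
| "interp D E \<gamma> InD a b c d e \<longleftrightarrow> a \<in> D"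
| "interp D E \<gamma> GapG a b c d e \<longleftrightarrow> a = \<gamma> \<or> (\<forall>\<xi>\<in>D. a < \<xi> \<longrightarrow> b \<le> \<xi>)"
| "interp D E \<gamma> Zero a b c d e \<longleftrightarrow> (\<forall>\<xi>. a \<le> \<xi>)"
| "interp D E \<gamma> InEG a b c d e \<longleftrightarrow> b = \<gamma> \<or> a \<in> E b"
| "interp D E \<gamma> NotInEG a b c d e \<longleftrightarrow> b = \<gamma> \<or> a \<notin> E b"
| "interp D E \<gamma> InE a b c d e \<longleftrightarrow> e \<le> d \<or> a \<noteq> b \<or> a \<in> E c"
| "interp D E \<gamma> NotInE a b c d e \<longleftrightarrow> e \<le> d \<or> a \<noteq> b \<or> a \<notin> E c"
| "interp D E \<gamma> NoneBetween a b c d e \<longleftrightarrow> (\<forall>\<xi>\<in>D. a < \<xi> \<longrightarrow> b < \<xi>)"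
| "interp D E \<gamma> LeMin a b c d e \<longleftrightarrow> a \<le> b \<or> (\<forall>\<xi>\<in>D. a \<le> \<xi>)"
| "interp D E \<gamma> (LadderG n) a b c d e \<longleftrightarrow> a = \<gamma> \<or> (\<exists>f. cofinal_seq f a) \<and> b = ladder a n"

text \<open>\<open>D\<close> is a tail of the club of a counterexample to subtlety. The structure at
  \<open>K\<close> is the target of the homomorphism, and the members of \<open>D\<close> below
  \<open>K\<close> index the factors of the product.\<close>

locale incoherent =
  fixes D :: "'a::wellorder set" and E :: "'a \<Rightarrow> 'a set" and K :: 'a
  assumes K: "K \<in> D"
    and E_sub: "\<gamma> \<in> D \<Longrightarrow> E \<gamma> \<subseteq> {..<\<gamma>}"
    and closed: "\<mu> < K \<Longrightarrow> \<xi> < \<mu> \<Longrightarrow> (\<And>\<xi>. \<xi> < \<mu> \<Longrightarrow> \<exists>\<beta>\<in>D. \<xi> < \<beta> \<and> \<beta> < \<mu>) \<Longrightarrow> \<mu> \<in> D"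
    and incoh: "\<beta> \<in> D \<Longrightarrow> \<gamma> \<in> D \<Longrightarrow> \<beta> < \<gamma> \<Longrightarrow> E \<beta> \<noteq> E \<gamma> \<inter> {..<\<beta>}"
begin

text \<open>For \<open>z \<le> K\<close> this is the last member of \<open>D\<close> up to
  \<open>z\<close>, or the least member of \<open>D\<close> if none is that small.\<close>

definition prev :: "'a \<Rightarrow> 'a" where
  "prev z = (LEAST \<xi>. \<xi> \<in> D \<and> (\<forall>\<zeta>\<in>D. \<xi> < \<zeta> \<longrightarrow> z < \<zeta>))"

text \<open>The \<open>else\<close> branch is the least element of the type.\<close>

definition diff :: "'a \<Rightarrow> 'a \<Rightarrow> 'a" where
  "diff \<eta> \<beta> = (if \<beta> \<in> D \<and> \<beta> < \<eta> then SOME \<xi>. \<xi> < \<beta> \<and> (\<xi> \<in> E \<beta>) \<noteq> (\<xi> \<in> E \<eta>) else (LEAST \<xi>. True))"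

definition cut :: "'a \<Rightarrow> 'a \<Rightarrow> 'a" where
  "cut \<alpha> = (\<lambda>\<beta>. min \<alpha> \<beta>)"

text \<open>A descent through \<open>D\<close>: each step takes a difference with
  \<open>E \<eta>\<close> and rounds it down to \<open>D\<close>. In the argument \<eta> is the
  value of the homomorphism at the previous descent, so the list records these values.\<close>

primrec desc :: "'a list \<Rightarrow> 'a \<Rightarrow> 'a" where
  "desc [] = (\<lambda>\<beta>. \<beta>)"
| "desc (\<eta> # l) = (\<lambda>\<beta>. prev (diff \<eta> (desc l \<beta>)))"

text \<open>The universe of the substructure \<open>X\<close>, as functions of the coordinate.
  Finite lists as parameters keep the number of their restrictions to the coordinates at most
  \<kappa>.\<close>

definition elems :: "('a \<Rightarrow> 'a) set" where
  "elems = cut ` {..K} \<union> desc ` lists (D \<inter> {..K}) \<union>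
    (\<lambda>(\<eta>, l). \<lambda>\<beta>. diff \<eta> (desc l \<beta>)) ` ((D \<inter> {..K}) \<times> lists (D \<inter> {..K}))"

text \<open>If \<beta> were the least ordinal, \<open>E \<beta>\<close> would be empty and so cohere
  with \<open>E K\<close>.\<close>

lemma zero_notin: "\<beta> \<in> D \<Longrightarrow> \<beta> < K \<Longrightarrow> \<exists>\<xi>. \<xi> < \<beta>"
  using incoh[of \<beta> K] K E_sub[of \<beta>] by fastforce

lemma diff_spec:
  assumes "\<beta> \<in> D" "\<beta> < \<eta>" "\<eta> \<in> D"
  shows "diff \<eta> \<beta> < \<beta>" "(diff \<eta> \<beta> \<in> E \<beta>) \<noteq> (diff \<eta> \<beta> \<in> E \<eta>)"
proof -
  have "\<exists>\<xi>. \<xi> < \<beta> \<and> (\<xi> \<in> E \<beta>) \<noteq> (\<xi> \<in> E \<eta>)"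
    using incoh[OF assms(1,3,2)] E_sub[OF assms(1)] by blast
  from someI_ex[OF this] show "diff \<eta> \<beta> < \<beta>" "(diff \<eta> \<beta> \<in> E \<beta>) \<noteq> (diff \<eta> \<beta> \<in> E \<eta>)"
    using assms by (auto simp: diff_def)
qed

text \<open>Where \<open>diff\<close> takes its default, the least ordinal,
  \<open>zero_notin\<close> applies; the member of \<open>D\<close> below \<open>K\<close> settles
  the case \<beta> = \<open>K\<close>.\<close>

lemma diff_less:
  assumes "\<beta> \<in> D" "\<beta> \<le> K" "\<exists>\<gamma>\<in>D. \<gamma> < K" "\<eta> \<in> D"
  shows "diff \<eta> \<beta> < \<beta>"
proof (cases "\<beta> < \<eta>")
  case True
  then show ?thesis using diff_spec assms by blast
next
  case False
  obtain \<xi> where "\<xi> < \<beta>" using assms zero_notin by (cases "\<beta> = K") fastforce+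
  then have "(LEAST \<xi>. True) < \<beta>" by (metis (full_types) Least_le le_less_trans)
  with False show ?thesis by (simp add: diff_def)
qed

text \<open>The supremum of the members of \<open>D\<close> up to \<open>z\<close> is in
  \<open>D\<close> by closure. The last two clauses have the shape of \<open>NoneBetween\<close> and
  \<open>LeMin\<close>, so that they transfer from the coordinates.\<close>

lemma prev:
  assumes "z \<le> K"
  shows "prev z \<in> D" "\<forall>\<zeta>\<in>D. prev z < \<zeta> \<longrightarrow> z < \<zeta>" "prev z \<le> z \<or> (\<forall>\<xi>\<in>D. prev z \<le> \<xi>)"
proof -
  let ?P = "\<lambda>\<xi>. \<xi> \<in> D \<and> (\<forall>\<zeta>\<in>D. \<xi> < \<zeta> \<longrightarrow> z < \<zeta>)"
  have ex: "\<exists>\<mu>. ?P \<mu> \<and> (\<mu> \<le> z \<or> (\<forall>\<xi>\<in>D. \<mu> \<le> \<xi>))"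
  proof (cases "\<exists>\<xi>\<in>D. \<xi> \<le> z")
    case False
    have "(LEAST \<xi>. \<xi> \<in> D) \<in> D" using K by (rule LeastI)
    moreover have "(LEAST \<xi>. \<xi> \<in> D) \<le> \<xi>" if "\<xi> \<in> D" for \<xi> using that by (rule Least_le)
    ultimately show ?thesis using False by force
  next
    case True
    let ?Q = "\<lambda>\<mu>. \<forall>\<zeta>\<in>D. \<zeta> \<le> z \<longrightarrow> \<zeta> \<le> \<mu>"
    define \<mu> where "\<mu> = (LEAST \<mu>. ?Q \<mu>)"
    have Q: "?Q \<mu>" unfolding \<mu>_def by (rule LeastI[of ?Q z]) simp
    have mz: "\<mu> \<le> z" unfolding \<mu>_def by (rule Least_le) simp
    have "\<mu> \<in> D"
    proof (rule ccontr)
      assume nD: "\<mu> \<notin> D"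
      then have "\<mu> < K" using mz assms K by (metis order.trans order.not_eq_order_implies_strict)
      moreover obtain d where d: "d \<in> D" "d \<le> z" using True by blast
      then have "d < \<mu>" using Q nD by (metis order.not_eq_order_implies_strict)
      moreover have "\<exists>\<beta>\<in>D. \<xi> < \<beta> \<and> \<beta> < \<mu>" if "\<xi> < \<mu>" for \<xi>
      proof -
        have "\<not> ?Q \<xi>" using that not_less_Least unfolding \<mu>_def by blast
        then obtain \<beta> where "\<beta> \<in> D" "\<beta> \<le> z" "\<xi> < \<beta>" by force
        then show ?thesis using Q nD by (metis order.not_eq_order_implies_strict)
      qed
      ultimately show False using closed nD by blast
    qed
    then show ?thesis using Q mz by force
  qed
  then obtain \<mu> where \<mu>: "?P \<mu>" "\<mu> \<le> z \<or> (\<forall>\<xi>\<in>D. \<mu> \<le> \<xi>)" by blast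
  have P: "?P (prev z)" unfolding prev_def using \<mu>(1) by (rule LeastI)
  have le: "prev z \<le> \<mu>" unfolding prev_def using \<mu>(1) by (rule Least_le)
  show "prev z \<in> D" "\<forall>\<zeta>\<in>D. prev z < \<zeta> \<longrightarrow> z < \<zeta>" using P by blast+
  show "prev z \<le> z \<or> (\<forall>\<xi>\<in>D. prev z \<le> \<xi>)" using \<mu>(2) le by (meson order.trans)
qed

text \<open>As \<open>diff\<close> lies strictly below the previous member of \<open>D\<close>,
  rounding it to \<open>D\<close> cannot exceed that member, even where the result is the least
  element of \<open>D\<close>.\<close>

lemma desc_mem:
  assumes "\<gamma> \<in> D" "\<gamma> < K" "\<beta> \<in> D" "\<beta> \<le> K" "set l \<subseteq> D"
  shows "desc l \<beta> \<in> D \<and> desc l \<beta> \<le> \<beta>"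
  using \<open>set l \<subseteq> D\<close>
proof (induction l)
  case Nil
  then show ?case using assms by simp
next
  case (Cons \<eta> l)
  then have IH: "desc l \<beta> \<in> D" "desc l \<beta> \<le> \<beta>" by auto
  then have lt: "diff \<eta> (desc l \<beta>) < desc l \<beta>"
    using assms Cons.prems by (intro diff_less) auto
  then have le: "diff \<eta> (desc l \<beta>) \<le> K" using IH assms by order
  from prev(1)[OF le] prev(3)[OF le] lt IH show ?case by auto
qed


text \<open>Here \<open>h\<close> is a homomorphism from the substructure on \<open>elems\<close> to
  the structure at \<open>K\<close>. The argument repeatedly picks a relation that is true at all
  coordinates and reads it off at \<open>K\<close>.\<close>

lemma no_hom:
  assumes ne: "\<exists>\<gamma>\<in>D. \<gamma> < K"
    and le_K: "\<And>a. a \<in> elems \<Longrightarrow> h a \<le> K"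
    and hom: "\<And>s a b c d e. {a, b, c, d, e} \<subseteq> elems \<Longrightarrow>
      (\<And>\<beta>. \<beta> \<in> D \<Longrightarrow> \<beta> < K \<Longrightarrow> interp D E \<beta> s (a \<beta>) (b \<beta>) (c \<beta>) (d \<beta>) (e \<beta>)) \<Longrightarrow>
      interp D E K s (h a) (h b) (h c) (h d) (h e)"
  shows False
proof -
  define j where "j \<alpha> = h (cut \<alpha>)" for \<alpha>
  have cut_in: "cut \<alpha> \<in> elems" if "\<alpha> \<le> K" for \<alpha> using that by (auto simp: elems_def)
  have j_le_K: "j \<alpha> \<le> K" if "\<alpha> \<le> K" for \<alpha> using that cut_in le_K by (simp add: j_def)
  have hom1: "interp D E K s (h a) (h a) (h a) (h a) (h a)"
    if "a \<in> elems" "\<And>\<beta>. \<beta> \<in> D \<Longrightarrow> \<beta> < K \<Longrightarrow> interp D E \<beta> s (a \<beta>) (a \<beta>) (a \<beta>) (a \<beta>) (a \<beta>)" for s a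
    using that by (intro hom) auto
  have hom2: "interp D E K s (h a) (h b) (h b) (h b) (h b)"
    if "a \<in> elems" "b \<in> elems" "\<And>\<beta>. \<beta> \<in> D \<Longrightarrow> \<beta> < K \<Longrightarrow> interp D E \<beta> s (a \<beta>) (b \<beta>) (b \<beta>) (b \<beta>) (b \<beta>)" for s a b
    using that by (intro hom) auto
  have jTop: "j \<alpha> = K" if "\<alpha> \<le> K" "\<And>\<beta>. \<beta> \<in> D \<Longrightarrow> \<beta> < K \<Longrightarrow> \<beta> \<le> \<alpha>" for \<alpha>
    using that hom1[of "cut \<alpha>" Top] cut_in by (simp add: j_def cut_def)
  have jK: "j K = K" by (rule jTop) auto
  have j_mono: "j \<alpha> \<le> j \<beta>" if "\<alpha> \<le> \<beta>" "\<beta> \<le> K" for \<alpha> \<beta>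
    using that hom2[of "cut \<alpha>" "cut \<beta>" Le] cut_in[of \<alpha>] cut_in[of \<beta>]
    by (simp add: j_def cut_def min.coboundedI1)
  \<comment> \<open>Below \<nu> the values of \<open>j\<close> differ from \<open>K\<close>, which
    excludes the first disjunct of the relations ending in \<open>G\<close>.\<close>
  define \<nu> where "\<nu> = (LEAST \<nu>. j \<nu> = K)"
  have j\<nu>: "j \<nu> = K" unfolding \<nu>_def using jK by (rule LeastI)
  have \<nu>_le: "\<nu> \<le> \<alpha>" if "j \<alpha> = K" for \<alpha> unfolding \<nu>_def using that by (rule Least_le)
  have \<nu>K: "\<nu> \<le> K" using jK by (rule \<nu>_le)
  have j_less_K: "j \<alpha> < K" if "\<alpha> < \<nu>" for \<alpha>
    using that \<nu>_le[of \<alpha>] j_le_K[of \<alpha>] \<nu>K by (metis leD le_less_trans order.not_eq_order_implies_strict order.strict_implies_order)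
  have j_strict: "j \<alpha> < j \<beta>" if "\<alpha> < \<beta>" "\<beta> \<le> K" "\<alpha> < \<nu>" for \<alpha> \<beta>
  proof -
    have "interp D E K LessG (j \<alpha>) (j \<beta>) (j \<beta>) (j \<beta>) (j \<beta>)"
      unfolding j_def using that by (intro hom2 cut_in) (auto simp: cut_def min_def)
    then show ?thesis using j_less_K[of \<alpha>] that by auto
  qed
  have jD: "j \<alpha> \<in> D" if "\<alpha> \<in> D" "\<alpha> \<le> K" for \<alpha>
    using that hom1[of "cut \<alpha>" InD] cut_in[of \<alpha>] by (simp add: j_def cut_def min_def)
  \<comment> \<open>The critical point of \<open>j\<close>, or \<nu> if \<open>j\<close> is the
    identity below \<nu>.\<close>
  define \<alpha> where "\<alpha> = (LEAST \<alpha>. j \<alpha> \<noteq> \<alpha> \<or> \<alpha> = \<nu>)"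
  have \<alpha>: "j \<alpha> \<noteq> \<alpha> \<or> \<alpha> = \<nu>" unfolding \<alpha>_def by (rule LeastI[of _ \<nu>]) simp
  have \<alpha>\<nu>: "\<alpha> \<le> \<nu>" unfolding \<alpha>_def by (rule Least_le) simp
  have fixed: "j \<xi> = \<xi>" if "\<xi> < \<alpha>" for \<xi> using not_less_Least[OF that[unfolded \<alpha>_def]] by simp
  have \<alpha>_le: "\<alpha> \<le> j \<alpha>"
  proof (rule ccontr)
    assume "\<not> \<alpha> \<le> j \<alpha>"
    then have "j (j \<alpha>) = j \<alpha>" "j \<alpha> < \<alpha>" using fixed by auto
    then show False using j_strict[of "j \<alpha>" \<alpha>] \<alpha>\<nu> \<nu>K by fastforce
  qed
  have "\<alpha> \<in> D"
  proof (rule ccontr)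
    assume nD: "\<alpha> \<notin> D"
    then have "\<alpha> \<noteq> K" using K by blast
    then have "\<alpha> < K" using \<alpha>\<nu> \<nu>K by order
    have moved: "\<alpha> < j \<alpha>" using \<alpha> \<alpha>_le \<open>\<alpha> < K\<close> j\<nu> by auto
    have "\<exists>\<xi>. \<xi> < \<alpha>"
    proof (rule ccontr)
      assume "\<not> (\<exists>\<xi>. \<xi> < \<alpha>)"
      then have "\<forall>\<xi>. \<alpha> \<le> \<xi>" by (simp add: not_less)
      then have "interp D E K Zero (j \<alpha>) (j \<alpha>) (j \<alpha>) (j \<alpha>) (j \<alpha>)"
        using \<open>\<alpha> < K\<close> unfolding j_def by (intro hom1 cut_in) (auto simp: cut_def min_def)
      then have "j \<alpha> \<le> \<alpha>" by simp
      with moved show False by simp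
    qed
    \<comment> \<open>As \<alpha> is neither in \<open>D\<close> nor a limit of \<open>D\<close>,
      some \<rho> < \<alpha> bounds the members of \<open>D\<close> below \<alpha>. No member lies
      strictly between \<rho> and the next one, \<sigma>.\<close>
    then obtain \<rho> where \<rho>: "\<rho> < \<alpha>" "\<And>\<beta>. \<beta> \<in> D \<Longrightarrow> \<beta> < \<alpha> \<Longrightarrow> \<beta> \<le> \<rho>"
      using closed[OF \<open>\<alpha> < K\<close>] nD by (meson not_le)
    have "\<rho> < \<nu>" using \<rho> \<alpha>\<nu> by order
    define \<sigma> where "\<sigma> = (LEAST \<sigma>. \<sigma> \<in> D \<and> \<alpha> < \<sigma>)"
    have \<sigma>: "\<sigma> \<in> D" "\<alpha> < \<sigma>"
      using LeastI[of "\<lambda>\<sigma>. \<sigma> \<in> D \<and> \<alpha> < \<sigma>" K] K \<open>\<alpha> < K\<close> by (auto simp: \<sigma>_def)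
    have \<sigma>_le: "\<sigma> \<le> \<beta>" if "\<beta> \<in> D" "\<rho> < \<beta>" for \<beta>
      unfolding \<sigma>_def using that \<rho>(2)[of \<beta>] nD by (intro Least_le) (metis leD neqE)
    have "\<sigma> \<le> K" using \<sigma>_le K \<rho> \<open>\<alpha> < K\<close> by auto
    have "\<sigma> \<noteq> K"
    proof
      assume "\<sigma> = K"
      then have "\<beta> \<le> \<rho>" if "\<beta> \<in> D" "\<beta> < K" for \<beta> using that \<sigma>_le by fastforce
      then have "j \<rho> = K" using \<rho> \<open>\<alpha> < K\<close> by (intro jTop) auto
      then show False using j_less_K \<open>\<rho> < \<nu>\<close> by auto
    qed
    then have "\<sigma> < K" using \<open>\<sigma> \<le> K\<close> by order
    \<comment> \<open>\<rho> is fixed by \<open>j\<close>, so \<open>GapG\<close> bounds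
      \<open>j \<sigma>\<close> by the first member of \<open>D\<close> above \<rho>, which is
      \<sigma>.\<close>
    have "interp D E K GapG (j \<rho>) (j \<sigma>) (j \<sigma>) (j \<sigma>) (j \<sigma>)"
      unfolding j_def using \<sigma>_le less_le_trans[OF _ \<sigma>_le] \<rho> \<open>\<alpha> < K\<close> \<open>\<sigma> \<le> K\<close>
      by (intro hom2 cut_in) (auto simp: cut_def min_def not_le less_imp_le)
    then have "j \<sigma> \<le> \<sigma>" using fixed[OF \<rho>(1)] \<rho> \<sigma> \<open>\<alpha> < K\<close> by auto
    moreover have "\<sigma> \<le> j \<sigma>"
      using j_strict[of \<rho> \<sigma>] \<open>\<rho> < \<nu>\<close> fixed[OF \<rho>(1)] \<rho>(1) \<sigma> \<open>\<sigma> \<le> K\<close> jD \<sigma>_le by auto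
    ultimately have j\<sigma>: "j \<sigma> = \<sigma>" by order
    then have "\<sigma> < \<nu>" using \<open>\<sigma> < K\<close> j\<nu> j_mono[of \<nu> \<sigma>] by (metis leD leI order.strict_implies_order)
    \<comment> \<open>Kunen's argument below \<open>\<sigma>\<close>: the critical sequence and its supremum\<close>
    define c where "c n = (j ^^ n) \<alpha>" for n
    have c_Suc: "c (Suc n) = j (c n)" for n by (simp add: c_def)
    have c_less: "c n < \<sigma>" for n
    proof (induction n)
      case 0
      then show ?case using \<sigma> by (simp add: c_def)
    next
      case (Suc n)
      then show ?case using j_strict[of "c n" \<sigma>] j\<sigma> \<open>\<sigma> < \<nu>\<close> \<open>\<sigma> < K\<close> by (simp add: c_Suc)
    qed
    have c_incr: "c n < c (Suc n)" for n
    proof (induction n)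
      case 0
      then show ?case using moved by (simp add: c_def)
    next
      case (Suc n)
      then show ?case
        using j_strict[of "c n" "c (Suc n)"] c_less[of n] c_less[of "Suc n"] \<open>\<sigma> < \<nu>\<close> \<open>\<sigma> < K\<close>
        by (auto simp: c_Suc)
    qed
    define \<mu> where "\<mu> = (LEAST \<mu>. \<forall>n. c n \<le> \<mu>)"
    have c_\<mu>: "c n \<le> \<mu>" for n
      using LeastI[of "\<lambda>\<mu>. \<forall>n. c n \<le> \<mu>" \<sigma>] c_less by (auto simp: \<mu>_def less_imp_le)
    have \<mu>_le: "\<mu> \<le> \<xi>" if "\<And>n. c n \<le> \<xi>" for \<xi>
      using that Least_le[of "\<lambda>\<mu>. \<forall>n. c n \<le> \<mu>" \<xi>] by (auto simp: \<mu>_def)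
    have "\<mu> < \<nu>" "\<mu> < K" using \<mu>_le[of \<sigma>] c_less \<open>\<sigma> < \<nu>\<close> \<open>\<sigma> < K\<close> by (auto intro: less_imp_le le_less_trans)
    have c_less_\<mu>: "c n < \<mu>" for n using c_incr[of n] c_\<mu>[of "Suc n"] by order
    have below: "\<exists>n. \<xi> < c n" if "\<xi> < \<mu>" for \<xi> using that \<mu>_le[of \<xi>] by (meson leD not_le)
    have "cofinal_seq c \<mu>" using below c_less_\<mu> by (auto simp: cofinal_seq_def)
    then have lad: "cofinal_seq (ladder \<mu>) \<mu>" by (rule cofinal_seq_ladder)
    then have ladder_less: "ladder \<mu> n < \<mu>" for n by (simp add: cofinal_seq_def)
    \<comment> \<open>\<open>LadderG\<close> transfers both that \<open>j \<mu>\<close> has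
      countable cofinality and that its ladder is the image under \<open>j\<close> of the ladder of
      \<mu>.\<close>
    have "interp D E K (LadderG n) (j \<mu>) (j (ladder \<mu> n)) (j (ladder \<mu> n)) (j (ladder \<mu> n)) (j (ladder \<mu> n))" for n
      unfolding j_def using \<open>\<mu> < K\<close> ladder_less[of n] \<open>cofinal_seq c \<mu>\<close>
      by (intro hom2 cut_in) (auto simp: cut_def min_def not_le)
    then have cof: "\<exists>f. cofinal_seq f (j \<mu>)" and lad_eq: "\<And>n. ladder (j \<mu>) n = j (ladder \<mu> n)"
      using less_imp_neq[OF j_less_K[OF \<open>\<mu> < \<nu>\<close>]] by auto
    have lad': "cofinal_seq (ladder (j \<mu>)) (j \<mu>)" using cof cofinal_seq_ladder by blast
    have small: "j \<xi> < \<mu>" if \<xi>: "\<xi> < \<mu>" for \<xi>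
    proof -
      obtain n where "\<xi> < c n" using below \<xi> by blast
      then have "j \<xi> \<le> c (Suc n)" unfolding c_Suc using c_less[of n] \<open>\<sigma> < K\<close> by (intro j_mono) auto
      then show ?thesis using c_less_\<mu>[of "Suc n"] by order
    qed
    have "\<mu> \<le> j \<mu>"
    proof (rule \<mu>_le)
      fix n
      show "c n \<le> j \<mu>" using c_incr[of n] j_mono[of "c n" \<mu>] c_\<mu>[of n] \<open>\<mu> < K\<close> unfolding c_Suc by fastforce
    qed
    moreover have "\<not> \<mu> < j \<mu>"
      using lad' small ladder_less unfolding cofinal_seq_def lad_eq by (meson less_asym)
    ultimately have j\<mu>: "j \<mu> = \<mu>" by order
    \<comment> \<open>A rung above \<alpha> is fixed by \<open>j\<close>. Applying \<open>j\<close>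
      repeatedly keeps the whole critical sequence at or below it, although \<mu> is the
      supremum.\<close>
    obtain n where n: "c 0 < ladder \<mu> n" using lad c_less_\<mu> unfolding cofinal_seq_def by blast
    let ?\<xi> = "ladder \<mu> n"
    have j\<xi>: "j ?\<xi> = ?\<xi>" using lad_eq[of n] j\<mu> by simp
    have "c k \<le> ?\<xi>" for k
    proof (induction k)
      case 0
      then show ?case using n by simp
    next
      case (Suc k)
      then have "j (c k) \<le> j ?\<xi>" using ladder_less[of n] \<open>\<mu> < K\<close> by (intro j_mono) auto
      then show ?case by (simp add: c_Suc j\<xi>)
    qed
    then show False using \<mu>_le[of ?\<xi>] ladder_less[of n] by auto
  qed
  \<comment> \<open>Otherwise \<alpha> is moved while all smaller ordinals are fixed, and
    \<open>InEG\<close> and \<open>NotInEG\<close> make \<open>E \<alpha>\<close> cohere with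
    \<open>E (j \<alpha>)\<close>.\<close>
  have "\<alpha> = \<nu>"
  proof (rule ccontr)
    assume "\<alpha> \<noteq> \<nu>"
    then have "\<alpha> < \<nu>" "\<alpha> < j \<alpha>" using \<alpha> \<alpha>_le \<alpha>\<nu> by auto
    have "j \<alpha> \<in> D" using \<open>\<alpha> \<in> D\<close> \<open>\<alpha> < \<nu>\<close> \<nu>K by (intro jD) auto
    moreover have "\<xi> \<in> E \<alpha> \<longleftrightarrow> \<xi> \<in> E (j \<alpha>)" if "\<xi> < \<alpha>" for \<xi>
    proof
      assume "\<xi> \<in> E \<alpha>"
      then have "interp D E K InEG (j \<xi>) (j \<alpha>) (j \<alpha>) (j \<alpha>) (j \<alpha>)"
        unfolding j_def using that \<open>\<alpha> < \<nu>\<close> \<nu>K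
        by (intro hom2 cut_in) (auto simp: cut_def min_def not_le)
      then show "\<xi> \<in> E (j \<alpha>)" using fixed[OF that] less_imp_neq[OF j_less_K[OF \<open>\<alpha> < \<nu>\<close>]] by auto
    next
      assume "\<xi> \<in> E (j \<alpha>)"
      moreover have "interp D E K NotInEG (j \<xi>) (j \<alpha>) (j \<alpha>) (j \<alpha>) (j \<alpha>)" if "\<xi> \<notin> E \<alpha>"
        unfolding j_def using that \<open>\<xi> < \<alpha>\<close> \<open>\<alpha> < \<nu>\<close> \<nu>K
        by (intro hom2 cut_in) (auto simp: cut_def min_def not_le)
      ultimately show "\<xi> \<in> E \<alpha>" using fixed[OF that] less_imp_neq[OF j_less_K[OF \<open>\<alpha> < \<nu>\<close>]] by auto
    qed
    ultimately show False
      using incoh[OF \<open>\<alpha> \<in> D\<close> _ \<open>\<alpha> < j \<alpha>\<close>] E_sub[OF \<open>\<alpha> \<in> D\<close>] by blast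
  qed
  with \<open>\<alpha> \<in> D\<close> fixed have "\<nu> \<in> D" and fixed: "\<And>\<xi>. \<xi> < \<nu> \<Longrightarrow> j \<xi> = \<xi>" by auto
  let ?L = "lists (D \<inter> {..K})"
  have desc_in: "desc l \<in> elems" if "l \<in> ?L" for l using that by (auto simp: elems_def)
  let ?P = "\<lambda>\<eta>. \<exists>l\<in>?L. h (desc l) = \<eta> \<and> \<nu> \<le> \<eta>"
  define \<eta> where "\<eta> = (LEAST \<eta>. ?P \<eta>)"
  have "h (desc []) = K"
    using hom1[of "desc []" Top] desc_in[of "[]"] by simp
  then have "?P K" using \<nu>K by (intro bexI[of _ "[]"]) auto
  then have "?P \<eta>" unfolding \<eta>_def by (rule LeastI)
  then obtain l where l: "l \<in> ?L" "h (desc l) = \<eta>" "\<nu> \<le> \<eta>" by blast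
  have descD: "desc l \<beta> \<in> D" "desc l \<beta> \<le> \<beta>" if "\<beta> \<in> D" "\<beta> < K" "l \<in> ?L" for l \<beta>
    using that desc_mem[of \<beta> \<beta> l] by (simp_all add: subset_iff less_imp_le in_lists_conv_set)
  have "\<eta> \<in> D" using l hom1[of "desc l" InD] desc_in[of l] descD by auto
  have "\<eta> \<le> K" using l le_K desc_in by auto
  define g where "g = (\<lambda>\<beta>. diff \<eta> (desc l \<beta>))"
  have g_in: "g \<in> elems" using l \<open>\<eta> \<in> D\<close> \<open>\<eta> \<le> K\<close> by (auto simp: elems_def g_def)
  have g_less: "g \<beta> < desc l \<beta>" if "\<beta> \<in> D" "\<beta> < K" for \<beta>
    unfolding g_def using descD[OF that l(1)] that \<open>\<eta> \<in> D\<close> by (intro diff_less) auto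
  then have hg: "h g < \<eta>" using hom2[of g "desc l" Less] g_in desc_in[OF l(1)] l by auto
  define y where "y = desc (\<eta> # l)"
  have l': "\<eta> # l \<in> ?L" using l \<open>\<eta> \<in> D\<close> \<open>\<eta> \<le> K\<close> by auto
  then have y_in: "y \<in> elems" unfolding y_def by (rule desc_in)
  have y: "y \<beta> = prev (g \<beta>)" for \<beta> by (simp add: y_def g_def)
  have g_le_K: "g \<beta> \<le> K" if "\<beta> \<in> D" "\<beta> < K" for \<beta> using g_less[OF that] descD[OF that l(1)] that by order
  have "interp D E K NoneBetween (h y) (h g) (h g) (h g) (h g)"
    using y_in g_in y prev(2) g_le_K by (intro hom2) auto
  then have nb: "\<And>\<xi>. \<xi> \<in> D \<Longrightarrow> h y < \<xi> \<Longrightarrow> h g < \<xi>" by auto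
  have "interp D E K LeMin (h y) (h g) (h g) (h g) (h g)"
    using y_in g_in y prev(3) g_le_K by (intro hom2) auto
  then have lm: "h y \<le> h g \<or> (\<forall>\<xi>\<in>D. h y \<le> \<xi>)" by auto
  \<comment> \<open>Otherwise the next descent \<open>y\<close> would have a value at least \<nu>
    but below \<eta>, contrary to the minimality of \<eta>.\<close>
  have "h g < \<nu>"
  proof (rule ccontr)
    assume "\<not> h g < \<nu>"
    then have "\<nu> \<le> h y" using nb[OF \<open>\<nu> \<in> D\<close>] by force
    then have "\<eta> \<le> h y" unfolding \<eta>_def using l' y_def by (intro Least_le) blast
    moreover have "h y < \<eta>" using lm hg \<open>\<nu> \<in> D\<close> \<open>\<not> h g < \<nu>\<close> by (meson le_less_trans not_le order.trans)
    ultimately show False by order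
  qed
  define \<zeta> where "\<zeta> = h g"
  have "\<zeta> < \<nu>" using \<open>h g < \<nu>\<close> by (simp add: \<zeta>_def)
  have "\<zeta> \<le> K" using \<open>\<zeta> < \<nu>\<close> \<nu>K by auto
  have h\<zeta>: "h (cut \<zeta>) = \<zeta>" using fixed[OF \<open>\<zeta> < \<nu>\<close>] by (simp add: j_def)
  \<comment> \<open>\<open>p < q\<close> guards the coordinates at which \<open>diff\<close> is meaningful and holds in \<open>K\<close>\<close>
  obtain p q where pq: "p \<in> elems" "q \<in> elems" "h p < h q"
    "\<And>\<beta>. \<beta> \<in> D \<Longrightarrow> \<beta> < K \<Longrightarrow> p \<beta> < q \<beta> \<Longrightarrow> desc l \<beta> < \<eta>"
  proof (cases "\<eta> = K")
    case True
    show ?thesis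
      using hg g_in desc_in[OF l(1)] l(2) True le_less_trans[OF descD(2)[OF _ _ l(1)]]
      by (intro that[of g "desc l"]) simp_all
  next
    \<comment> \<open>The guard \<open>desc l < cut \<nu>\<close> forces
      \<open>desc l \<beta>\<close> below \<nu> \<le> \<eta>, and at \<open>K\<close> it reads
      \<eta> < \<open>K\<close>, since \<open>j \<nu> = K\<close>.\<close>
    case False
    then show ?thesis
      using hg g_in desc_in[OF l(1)] l descD[OF _ _ l(1)] \<open>\<eta> \<le> K\<close> j\<nu> cut_in \<nu>K
      by (intro that[of "desc l" "cut \<nu>"]) (auto simp: j_def cut_def)
  qed
  \<comment> \<open>\<open>g \<beta>\<close> is below \<beta>; if it equals the truncation of
    \<zeta>, it is \<zeta> itself, so \<zeta> is the chosen difference at \<beta>.\<close>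
  have key: "cut \<zeta> \<beta> = \<zeta> \<and> (\<zeta> \<in> E (desc l \<beta>)) \<noteq> (\<zeta> \<in> E \<eta>)"
    if "\<beta> \<in> D" "\<beta> < K" "p \<beta> < q \<beta>" "g \<beta> = cut \<zeta> \<beta>" for \<beta>
  proof -
    have "g \<beta> < \<beta>" using g_less descD that l(1) by (meson less_le_trans)
    then have "g \<beta> = \<zeta>" using that by (auto simp: cut_def min_def split: if_splits)
    then show ?thesis using that diff_spec(2)[of "desc l \<beta>" \<eta>] descD l(1) pq(4) \<open>\<eta> \<in> D\<close> by (simp add: g_def)
  qed
  have in5: "{g, cut \<zeta>, desc l, p, q} \<subseteq> elems" using g_in cut_in \<open>\<zeta> \<le> K\<close> desc_in[OF l(1)] pq by auto
  \<comment> \<open>At a guarded coordinate where \<open>g\<close> agrees with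
    \<open>cut \<zeta>\<close>, \<open>E (desc l \<beta>)\<close> and \<open>E \<eta>\<close>
    disagree about \<zeta>. At \<open>K\<close> the guard and the agreement hold and
    \<open>desc l\<close> becomes \<eta>, so \<open>E \<eta>\<close> would disagree with
    itself.\<close>
  show False
  proof (cases "\<zeta> \<in> E \<eta>")
    case True
    have "interp D E \<beta> NotInE (g \<beta>) (cut \<zeta> \<beta>) (desc l \<beta>) (p \<beta>) (q \<beta>)" if "\<beta> \<in> D" "\<beta> < K" for \<beta>
      using key[OF that] True by (cases "p \<beta> < q \<beta>") auto
    from hom[OF in5 this] show False using True pq(3) l(2) h\<zeta> by (simp add: \<zeta>_def)
  next
    case False
    have "interp D E \<beta> InE (g \<beta>) (cut \<zeta> \<beta>) (desc l \<beta>) (p \<beta>) (q \<beta>)" if "\<beta> \<in> D" "\<beta> < K" for \<beta>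
      using key[OF that] False by (cases "p \<beta> < q \<beta>") auto
    from hom[OF in5 this] show False using False pq(3) l(2) h\<zeta> by (simp add: \<zeta>_def)
  qed
qed

end

section \<open>The ordinals as a well-ordered type\<close>

lemma foundation_irrefl: "x \<notin> elts (x::'v::zfc)"
  using foundation by (auto dest: wf_not_refl)

lemma foundation_asym: "x \<in> elts y \<Longrightarrow> y \<notin> elts (x::'v::zfc)"
  using foundation by (auto dest: wf_not_sym)

lemma ordinal_elt: "ordinal \<alpha> \<Longrightarrow> \<beta> \<in> elts \<alpha> \<Longrightarrow> ordinal \<beta>"
  unfolding ordinal_def by blast

lemma ordinal_trans: "ordinal \<alpha> \<Longrightarrow> \<beta> \<in> elts \<alpha> \<Longrightarrow> \<gamma> \<in> elts \<beta> \<Longrightarrow> \<gamma> \<in> elts \<alpha>"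
  unfolding ordinal_def by blast

text \<open>By double induction along membership: incomparable ordinals would have the same
  elements.\<close>

lemma ordinal_linear:
  assumes "ordinal \<alpha>" "ordinal \<beta>"
  shows "\<alpha> \<in> elts \<beta> \<or> \<alpha> = \<beta> \<or> \<beta> \<in> elts \<alpha>"
  using assms
proof (induction \<alpha> arbitrary: \<beta> rule: wf_induct_rule[OF foundation])
  case (1 \<alpha>)
  note IH\<alpha> = 1(1) and \<alpha> = 1(2)
  show ?case
    using \<open>ordinal \<beta>\<close>
  proof (induction \<beta> rule: wf_induct_rule[OF foundation])
    case (1 \<beta>)
    note IH\<beta> = 1(1) and \<beta> = 1(2)
    show ?case
    proof (rule ccontr)
      assume no: "\<not> ?case"
      have "elts \<alpha> = elts \<beta>"
      proof (intro equalityI subsetI)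
        fix \<xi> assume \<xi>: "\<xi> \<in> elts \<alpha>"
        then have "\<xi> \<in> elts \<beta> \<or> \<xi> = \<beta> \<or> \<beta> \<in> elts \<xi>" using IH\<alpha> \<alpha> \<beta> ordinal_elt by auto
        then show "\<xi> \<in> elts \<beta>" using no \<xi> ordinal_trans[OF \<alpha> \<xi>] by auto
      next
        fix \<xi> assume \<xi>: "\<xi> \<in> elts \<beta>"
        then have "\<alpha> \<in> elts \<xi> \<or> \<alpha> = \<xi> \<or> \<xi> \<in> elts \<alpha>" using IH\<beta> \<alpha> \<beta> ordinal_elt by auto
        then show "\<xi> \<in> elts \<alpha>" using no \<xi> ordinal_trans[OF \<beta> \<xi>] by auto
      qed
      then show False using no extensionality by blast
    qed
  qed
qed

typedef (overloaded) ('v::zfc) ord = "{x::'v. ordinal x}" morphisms oset Ord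
  by (rule exI[of _ "vset {}"]) (simp add: ordinal_def elts_vset)

lemma ordinal_oset [simp]: "ordinal (oset a)"
  using oset[of a] by simp

lemma oset_Ord [simp]: "ordinal x \<Longrightarrow> oset (Ord x) = x"
  by (simp add: Ord_inverse)

instantiation ord :: (zfc) wellorder
begin

definition less_ord_def: "a < b \<longleftrightarrow> oset a \<in> elts (oset b)"

definition less_eq_ord_def: "a \<le> b \<longleftrightarrow> a = b \<or> a < (b::'a ord)"

instance
proof
  fix a b c :: "'a ord"
  show "a < b \<longleftrightarrow> a \<le> b \<and> \<not> b \<le> a"
    by (auto simp: less_ord_def less_eq_ord_def foundation_irrefl foundation_asym)
  show "a \<le> a" by (simp add: less_eq_ord_def)
  show "a \<le> c" if "a \<le> b" "b \<le> c"
    using that ordinal_trans[of "oset c" "oset b" "oset a"] by (auto simp: less_ord_def less_eq_ord_def)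
  show "a = b" if "a \<le> b" "b \<le> a"
    using that by (auto simp: less_ord_def less_eq_ord_def foundation_asym)
  show "a \<le> b \<or> b \<le> a"
    using ordinal_linear[of "oset a" "oset b"] by (auto simp: less_ord_def less_eq_ord_def oset_inject)
next
  fix P :: "'a ord \<Rightarrow> bool" and a :: "'a ord"
  assume step: "\<And>x. (\<And>y. y < x \<Longrightarrow> P y) \<Longrightarrow> P x"
  have "\<forall>a. oset a = x \<longrightarrow> P a" for x :: 'a
  proof (induction x rule: wf_induct_rule[OF foundation])
    case (1 x)
    then show ?case using step by (auto simp: less_ord_def)
  qed
  then show "P a" by blast
qed

end

lemma elts_oset: "elts (oset a) = oset ` {..<a}"
proof (intro equalityI subsetI)
  fix x assume x: "x \<in> elts (oset a)"
  then have "ordinal x" using ordinal_elt[of "oset a"] by simp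
  then show "x \<in> oset ` {..<a}" using x by (intro image_eqI[of _ _ "Ord x"]) (auto simp: less_ord_def)
qed (auto simp: less_ord_def)

lemma ball_elts_oset: "(\<forall>x\<in>elts (oset a). P x) \<longleftrightarrow> (\<forall>b<a. P (oset b))"
  by (auto simp: elts_oset)

lemma bex_elts_oset: "(\<exists>x\<in>elts (oset a). P x) \<longleftrightarrow> (\<exists>b<a. P (oset b))"
  by (auto simp: elts_oset)

lemma oset_mem_iff [simp]: "oset a \<in> elts (oset b) \<longleftrightarrow> a < b"
  by (simp add: less_ord_def)

lemma inj_oset: "inj_on oset A"
  by (auto simp: inj_on_def oset_inject)

lemma elts_oset_eqpoll: "elts (oset a) \<approx> {..<a}"
  unfolding elts_oset by (rule inj_on_image_eqpoll_self) (rule inj_oset)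

lemma eqpoll_cong: "A \<approx> A' \<Longrightarrow> B \<approx> B' \<Longrightarrow> A \<approx> B \<longleftrightarrow> A' \<approx> B'"
  by (meson eqpoll_sym eqpoll_trans)

lemma cardinal_oset: "cardinal (oset a) \<longleftrightarrow> is_card a"
  unfolding cardinal_def is_card_def ball_elts_oset
  by (simp add: eqpoll_cong[OF elts_oset_eqpoll elts_oset_eqpoll])

lemma finite_elts_oset [simp]: "finite (elts (oset a)) \<longleftrightarrow> finite {..<a}"
  by (rule eqpoll_finite_iff) (rule elts_oset_eqpoll)

lemma small_ords: "A \<subseteq> {..<a} \<Longrightarrow> small (oset ` A)"
  by (rule small_subset[OF small_elts[of "oset a"]]) (auto simp: elts_oset)

lemma elts_vset_ords: "A \<subseteq> {..<a} \<Longrightarrow> elts (vset (oset ` A)) = oset ` A"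
  by (rule elts_vset) (rule small_ords)

lemma oset_mem_image [simp]: "oset a \<in> oset ` A \<longleftrightarrow> a \<in> A"
  by (auto simp: oset_inject)

lemma unbounded_in_oset:
  "unbounded_in C (oset \<mu>) \<longleftrightarrow> (\<forall>\<xi><\<mu>. \<exists>\<beta>. oset \<beta> \<in> elts C \<and> \<xi> < \<beta> \<and> \<beta> < \<mu>)"
proof -
  have "(\<exists>\<beta>\<in>elts C \<inter> elts (oset \<mu>). oset \<xi> \<in> elts \<beta>) \<longleftrightarrow> (\<exists>\<beta>\<in>elts (oset \<mu>). \<beta> \<in> elts C \<and> oset \<xi> \<in> elts \<beta>)" for \<xi>
    by blast
  then show ?thesis unfolding unbounded_in_def ball_elts_oset by (auto simp: bex_elts_oset)
qed

lemma club_oset: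
  assumes "elts C \<subseteq> elts (oset \<delta>)"
  shows "club C (oset \<delta>) \<longleftrightarrow> club_in \<delta> {a. oset a \<in> elts C}"
proof -
  have "oset a \<in> elts C \<Longrightarrow> a < \<delta>" for a using assms by auto
  then show ?thesis
    using assms unfolding club_def club_in_def unbounded_in_oset elts_oset[of \<delta>]
    by (auto simp: elts_oset unbounded_in_oset; blast)
qed

lemma subtle_oset:
  "subtle (oset \<delta>) \<longleftrightarrow> is_card \<delta> \<and> infinite {..<\<delta>} \<and> coherent_below \<delta>"
proof -
  have "coherent_below \<delta>" if s: "subtle (oset \<delta>)"
    unfolding coherent_below_def
  proof (intro allI impI)
    fix E C assume EC: "(\<forall>\<gamma><\<delta>. E \<gamma> \<subseteq> {..<\<gamma>}) \<and> club_in \<delta> C"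
    then have C: "C \<subseteq> {..<\<delta>}" by (auto simp: club_in_def)
    define C' where "C' = vset (oset ` C)"
    have C': "elts C' = oset ` C" unfolding C'_def using C by (rule elts_vset_ords)
    then have "club C' (oset \<delta>)" using C EC by (subst club_oset) (auto simp: elts_oset)
    define E' where "E' x = vset (oset ` E (Ord x))" for x
    have E': "elts (E' (oset \<gamma>)) = oset ` E \<gamma>" if "\<gamma> < \<delta>" for \<gamma>
      unfolding E'_def oset_inverse using EC that by (intro elts_vset_ords[of _ \<gamma>]) blast
    have "\<forall>\<gamma>\<in>elts (oset \<delta>). elts (E' \<gamma>) \<subseteq> elts \<gamma>"
      unfolding ball_elts_oset using EC E' by (simp add: elts_oset image_mono)
    with \<open>club C' (oset \<delta>)\<close> s obtain \<beta> \<gamma> where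
      "\<beta> \<in> elts C'" "\<gamma> \<in> elts C'" "\<beta> \<in> elts \<gamma>" "elts (E' \<beta>) = elts (E' \<gamma>) \<inter> elts \<beta>"
      unfolding subtle_def by meson
    then obtain b c where bc: "b \<in> C" "c \<in> C" "b < c" "elts (E' (oset b)) = elts (E' (oset c)) \<inter> elts (oset b)"
      by (auto simp: C')
    then have "oset ` E b = oset ` (E c \<inter> {..<b})"
      using E' C by (auto simp: elts_oset oset_inject subset_iff)
    then have "E b = E c \<inter> {..<b}" by (simp add: inj_image_eq_iff inj_oset)
    then show "\<exists>\<beta>\<in>C. \<exists>\<gamma>\<in>C. \<beta> < \<gamma> \<and> E \<beta> = E \<gamma> \<inter> {..<\<beta>}" using bc by blast
  qed
  moreover have "subtle (oset \<delta>)" if c: "is_card \<delta>" "infinite {..<\<delta>}" "coherent_below \<delta>"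
    unfolding subtle_def
  proof (intro conjI allI impI)
    show "cardinal (oset \<delta>)" "infinite (elts (oset \<delta>))" using c by (simp_all add: cardinal_oset)
    fix E C assume EC: "(\<forall>\<gamma>\<in>elts (oset \<delta>). elts (E \<gamma>) \<subseteq> elts \<gamma>) \<and> club C (oset \<delta>)"
    then have C: "elts C \<subseteq> elts (oset \<delta>)" by (auto simp: club_def)
    define E' where "E' \<gamma> = {\<xi>. oset \<xi> \<in> elts (E (oset \<gamma>))}" for \<gamma>
    have sub: "E' \<gamma> \<subseteq> {..<\<gamma>}" if "\<gamma> < \<delta>" for \<gamma>
      using EC that by (fastforce simp: E'_def elts_oset[of \<delta>])
    then obtain \<beta> \<gamma> where bc: "oset \<beta> \<in> elts C" "oset \<gamma> \<in> elts C" "\<beta> < \<gamma>" "E' \<beta> = E' \<gamma> \<inter> {..<\<beta>}"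
      using c(3) EC club_oset[OF C] unfolding coherent_below_def
      by (metis (mono_tags, lifting) mem_Collect_eq)
    have "\<gamma> < \<delta>" "\<beta> < \<delta>" using C bc by auto
    have "elts (E (oset \<alpha>)) = oset ` E' \<alpha>" if "\<alpha> < \<delta>" for \<alpha>
      using EC that by (force simp: E'_def elts_oset)
    then have "elts (E (oset \<beta>)) = elts (E (oset \<gamma>)) \<inter> elts (oset \<beta>)"
      using \<open>\<gamma> < \<delta>\<close> \<open>\<beta> < \<delta>\<close> bc(4) by (auto simp: elts_oset oset_inject)
    then show "\<exists>\<beta>\<in>elts C. \<exists>\<gamma>\<in>elts C. \<beta> \<in> elts \<gamma> \<and> elts (E \<beta>) = elts (E \<gamma>) \<inter> elts \<beta>"
      using bc by (intro bexI[of _ "oset \<beta>"] bexI[of _ "oset \<gamma>"]) auto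
  qed
  ultimately show ?thesis by (auto simp: subtle_def cardinal_oset)
qed

section \<open>Ranks of ordinals, pairs and tuples in the cumulative hierarchy\<close>

abbreviation V_below :: "'v::zfc ord \<Rightarrow> 'v set" where
  "V_below a \<equiv> elts (Vlev (oset a))"

lemma V_below_iff: "x \<in> V_below a \<longleftrightarrow> (\<exists>b<a. elts x \<subseteq> V_below b)"
  by (subst elts_Vlev) (auto simp: elts_oset)

lemma V_below_mono: "a \<le> b \<Longrightarrow> V_below a \<subseteq> V_below b"
  by (meson V_below_iff less_le_trans subsetI)

lemma V_below_trans: "x \<in> V_below a \<Longrightarrow> y \<in> elts x \<Longrightarrow> y \<in> V_below a"
  by (meson V_below_iff V_below_mono less_imp_le subset_iff)

lemma V_below_oset [simp]: "oset b \<in> V_below a \<longleftrightarrow> b < a"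
proof (induction b arbitrary: a rule: less_induct)
  case (less b)
  have "elts (oset b) \<subseteq> V_below c \<longleftrightarrow> (\<forall>d<b. d < c)" for c
    using less by (simp add: subset_eq ball_elts_oset)
  then have "oset b \<in> V_below a \<longleftrightarrow> (\<exists>c<a. \<forall>d<b. d < c)"
    by (simp add: V_below_iff[of "oset b"])
  also have "\<dots> \<longleftrightarrow> b < a"
    by (meson le_less_trans less_irrefl not_le)
  finally show ?case .
qed

definition osuc :: "'v::zfc ord \<Rightarrow> 'v ord" where
  "osuc a = Ord (vset (insert (oset a) (elts (oset a))))"

lemma elts_osuc: "elts (oset (osuc a)) = oset ` {..a}"
proof -
  have *: "elts (vset (insert (oset a) (elts (oset a)))) = insert (oset a) (elts (oset a))"
    by (simp add: elts_vset small_insert)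
  have "ordinal (vset (insert (oset a) (elts (oset a))))"
    unfolding ordinal_def * using ordinal_oset[of a] unfolding ordinal_def by blast
  then have "elts (oset (osuc a)) = insert (oset a) (elts (oset a))" by (simp add: osuc_def *)
  then show ?thesis by (simp add: elts_oset atMost_def lessThan_def order_le_less Collect_disj_eq)
qed

lemma less_osuc [simp]: "b < osuc a \<longleftrightarrow> b \<le> a"
  by (metis atMost_iff elts_osuc oset_mem_iff oset_mem_image)

lemma V_below_osuc: "x \<in> V_below (osuc a) \<longleftrightarrow> elts x \<subseteq> V_below a"
  by (metis V_below_iff V_below_mono less_osuc order_refl subset_trans)

lemma opair_V_below:
  assumes "x \<in> V_below a" "y \<in> V_below a"
  shows "opair x y \<in> V_below (osuc (osuc a))"
  using assms unfolding opair_def by (simp add: V_below_osuc elts_vset small_insert)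

lemma opair_V_belowD: "opair x y \<in> V_below a \<Longrightarrow> x \<in> V_below a"
  by (rule V_below_trans[of "vset {x}"], rule V_below_trans[of "opair x y"])
    (simp_all add: opair_def elts_vset small_insert)

text \<open>Each pairing raises the level by two; the hypothesis on \<open>vset {}\<close> places
  the code of the empty list.\<close>

lemma tuple_V_below:
  assumes "set xs \<subseteq> V_below a" "vset {} \<in> V_below a"
  shows "tuple xs \<in> V_below ((osuc ^^ (2 * length xs)) a)"
  using assms(1)
proof (induction xs)
  case Nil
  then show ?case using assms(2) by (simp add: tuple_def)
next
  case (Cons x xs)
  let ?b = "(osuc ^^ (2 * length xs)) a"
  have "a \<le> (osuc ^^ n) a" for n
  proof (induction n)
    case (Suc n)
    then show ?case by (simp add: less_imp_le)
  qed simp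
  then have "x \<in> V_below ?b" using Cons.prems V_below_mono by (metis list.set_intros(1) subset_iff)
  then show ?case using Cons opair_V_below[of x ?b "tuple xs"] by (simp add: tuple_def)
qed

lemma osuc_less_card:
  assumes "is_card \<kappa>" "infinite {..<\<kappa>}" "a < \<kappa>"
  shows "osuc a < \<kappa>"
proof -
  obtain b where "a < b" "b < \<kappa>" using is_card_unbounded assms by blast
  then have "osuc a \<le> b" by (metis less_osuc not_le)
  then show ?thesis using \<open>b < \<kappa>\<close> by order
qed

lemma osuc_pow_less_card:
  assumes "is_card \<kappa>" "infinite {..<\<kappa>}" "a < \<kappa>"
  shows "(osuc ^^ n) a < \<kappa>"
  using assms osuc_less_card by (induction n) auto

section \<open>Subtlety implies reflection\<close>

lemma elts_inter_class: "elts (vset (elts x \<inter> A)) = elts x \<inter> A"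
  by (rule elts_vset) (rule small_subset[OF small_elts[of x]], simp)

lemma fun_of_product:
  assumes "f \<in> elts (Fsym L)" "xs \<in> seqs (universe (product L S)) (farity L f)" "\<A> \<in> elts S"
  shows "app (fun_of (product L S) f xs) \<A> = fun_of \<A> f (map (\<lambda>x. app x \<A>) xs)"
  using assms unfolding product_def by (simp add: fun_of_mk_structure)

lemma rel_of_product:
  assumes "r \<in> elts (Rsym L)" "xs \<in> seqs (universe (product L S)) (rarity L r)"
  shows "rel_of (product L S) r xs \<longleftrightarrow> (\<forall>\<A>\<in>elts S. rel_of \<A> r (map (\<lambda>x. app x \<A>) xs))"
  using assms unfolding product_def by (simp add: rel_of_mk_structure)

lemma app_universe_product:
  assumes "x \<in> elts (universe (product L S))" "\<A> \<in> elts S"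
  shows "app x \<A> \<in> elts (universe \<A>)"
  using assms by (auto simp: product_def elts_product_universe)

lemma coherent_imp_WPSR:
  fixes \<delta> :: "'v::zfc ord" and L :: "'v language"
  assumes card: "is_card \<delta>" and unc: "uncountable {..<\<delta>}" and coh: "coherent_below \<delta>"
    and L: "countable_language L" and ne: "elts \<C> \<noteq> {}" and str: "\<forall>\<A>\<in>elts \<C>. is_structure L \<A>"
    and sub: "elts \<C> \<subseteq> V_below \<delta>"
  shows "\<exists>\<kappa><\<delta>. is_card \<kappa> \<and> infinite {..<\<kappa>} \<and> WPSR L (elts \<C>) (oset \<kappa>)"
proof (rule ccontr)
  assume no: "\<not> ?thesis"
  interpret uncountable_subtle \<delta> by standard (fact card unc coh)+
  obtain eF :: "'v \<Rightarrow> nat" where eF: "inj_on eF (elts (Fsym L))"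
    using L by (auto simp: countable_language_def elim: countableE)
  obtain eR :: "'v \<Rightarrow> nat" where eR: "inj_on eR (elts (Rsym L))"
    using L by (auto simp: countable_language_def elim: countableE)
  define S where "S \<kappa> = vset (elts \<C> \<inter> V_below \<kappa>)" for \<kappa>
  have S: "elts (S \<kappa>) = elts \<C> \<inter> V_below \<kappa>" for \<kappa> unfolding S_def by (rule elts_inter_class)
  obtain \<A>\<^sub>0 where \<A>\<^sub>0: "\<A>\<^sub>0 \<in> elts \<C>" using ne by blast
  then obtain \<alpha>\<^sub>0 where \<alpha>\<^sub>0: "\<alpha>\<^sub>0 < \<delta>" "elts \<A>\<^sub>0 \<subseteq> V_below \<alpha>\<^sub>0" using sub V_below_iff by blast
  \<comment> \<open>Above \<open>\<alpha>\<^sub>0\<close> the set \<C> has a member in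
    \<open>V_below \<kappa>\<close>, so a failure of \<open>WPSR\<close> provides \<open>X\<close>
    and \<open>B\<close>.\<close>
  define good where "good \<kappa> \<longleftrightarrow> \<alpha>\<^sub>0 < \<kappa> \<and> \<kappa> < \<delta> \<and> is_card \<kappa> \<and> infinite {..<\<kappa>}" for \<kappa>
  define bad where "bad \<kappa> X B b i \<longleftrightarrow> B \<in> elts \<C> \<and> substructure L X (product L (S \<kappa>)) \<and>
      (\<nexists>h. homomorphism L h X B) \<and> inj_on i (elts (universe X)) \<and> i ` elts (universe X) \<subseteq> {..<\<kappa>} \<and>
      b < \<delta> \<and> elts B \<subseteq> V_below b" for \<kappa> X B b and i :: "'v \<Rightarrow> 'v ord"
  have "\<exists>X B b i. bad \<kappa> X B b i" if \<kappa>: "good \<kappa>" for \<kappa>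
  proof -
    have "\<not> WPSR L (elts \<C>) (oset \<kappa>)" using no \<kappa> by (auto simp: good_def)
    moreover have "\<A>\<^sub>0 \<in> V_below \<kappa>" using \<kappa> \<alpha>\<^sub>0 V_below_iff unfolding good_def by blast
    ultimately obtain X B where XB: "B \<in> elts \<C>" "substructure L X (product L (S \<kappa>))"
      "elts (universe X) \<lesssim> elts (oset \<kappa>)" "\<nexists>h. homomorphism L h X B"
      using \<A>\<^sub>0 unfolding WPSR_def S_def by blast
    have "elts (universe X) \<lesssim> {..<\<kappa>}" using XB(3) elts_oset_eqpoll by (rule lepoll_trans2)
    then obtain i where "inj_on i (elts (universe X))" "i ` elts (universe X) \<subseteq> {..<\<kappa>}"
      by (auto simp: lepoll_def)
    moreover obtain b where "b < \<delta>" "elts B \<subseteq> V_below b" using XB(1) sub V_below_iff by blast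
    ultimately show ?thesis using XB unfolding bad_def by blast
  qed
  then obtain X B b i where bad: "\<And>\<kappa>. good \<kappa> \<Longrightarrow> bad \<kappa> (X \<kappa>) (B \<kappa>) (b \<kappa>) (i \<kappa>)" by metis
  define U where "U \<kappa> = elts (universe (X \<kappa>))" for \<kappa>
  \<comment> \<open>The positive atomic diagram of \<open>X \<kappa>\<close> under the coding
    \<open>i \<kappa>\<close>: tag 0 for the universe, odd tags for functions with the value first,
    positive even tags for relations.\<close>
  define \<Phi> where "\<Phi> \<kappa> = (if good \<kappa> then {(0, [i \<kappa> a]) | a. a \<in> U \<kappa>} \<union>
     {(Suc (2 * eF f), i \<kappa> (fun_of (X \<kappa>) f as) # map (i \<kappa>) as) | f as.
        f \<in> elts (Fsym L) \<and> as \<in> seqs (universe (X \<kappa>)) (farity L f)} \<union>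
     {(Suc (Suc (2 * eR r)), map (i \<kappa>) as) | r as.
        r \<in> elts (Rsym L) \<and> as \<in> seqs (universe (X \<kappa>)) (rarity L r) \<and> rel_of (X \<kappa>) r as}
     else {})" for \<kappa>
  have i_inj: "inj_on (i \<kappa>) (U \<kappa>)" and i_sub: "i \<kappa> ` U \<kappa> \<subseteq> {..<\<kappa>}"
    and Xsub: "substructure L (X \<kappa>) (product L (S \<kappa>))" if "good \<kappa>" for \<kappa>
    using bad[OF that] by (auto simp: bad_def U_def)
  have Xclosed: "fun_of (X \<kappa>) f as \<in> U \<kappa>"
    if "good \<kappa>" "f \<in> elts (Fsym L)" "as \<in> seqs (universe (X \<kappa>)) (farity L f)" for \<kappa> f as
    using Xsub[OF that(1)] that(2,3) unfolding U_def substructure_def by (blast intro: fun_of_closed)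
  have odd: "2 * m \<noteq> Suc (2 * n)" "Suc (2 * n) \<noteq> 2 * m" for m n :: nat by presburger+
  have \<Phi>0: "(0, l) \<in> \<Phi> \<kappa> \<longleftrightarrow> (\<exists>a\<in>U \<kappa>. l = [i \<kappa> a])" if "good \<kappa>" for \<kappa> l
    using that by (auto simp: \<Phi>_def)
  have \<Phi>F: "(Suc (2 * n), l) \<in> \<Phi> \<kappa> \<longleftrightarrow> (\<exists>f as. n = eF f \<and> l = i \<kappa> (fun_of (X \<kappa>) f as) # map (i \<kappa>) as \<and>
      f \<in> elts (Fsym L) \<and> as \<in> seqs (universe (X \<kappa>)) (farity L f))" if "good \<kappa>" for \<kappa> n l
    using that by (auto simp: \<Phi>_def odd)
  have \<Phi>R: "(Suc (Suc (2 * n)), l) \<in> \<Phi> \<kappa> \<longleftrightarrow> (\<exists>r as. n = eR r \<and> l = map (i \<kappa>) as \<and>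
      r \<in> elts (Rsym L) \<and> as \<in> seqs (universe (X \<kappa>)) (rarity L r) \<and> rel_of (X \<kappa>) r as)" if "good \<kappa>" for \<kappa> n l
    using that by (auto simp: \<Phi>_def odd)
  have \<Phi>: "\<Phi> \<kappa> \<subseteq> UNIV \<times> lists {..<\<kappa>}" if "\<kappa> < \<delta>" for \<kappa>
  proof (cases "good \<kappa>")
    case True
    have lt: "i \<kappa> a < \<kappa>" if "a \<in> U \<kappa>" for a using i_sub[OF True] that by blast
    then have "i \<kappa> a < \<kappa>" if "as \<in> seqs (universe (X \<kappa>)) n" "a \<in> set as" for as n a
      using that by (auto simp: seqs_def U_def subset_iff)
    then show ?thesis using lt Xclosed[OF True] by (auto simp: \<Phi>_def True)
  qed (simp add: \<Phi>_def)
  define r where "r \<kappa> = (if good \<kappa> then b \<kappa> else \<alpha>\<^sub>0)" for \<kappa>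
  have r: "r \<kappa> < \<delta>" if "\<kappa> < \<delta>" for \<kappa> using bad[of \<kappa>] \<alpha>\<^sub>0(1) by (simp add: r_def bad_def)
  obtain \<kappa> \<mu> where \<kappa>\<mu>: "\<alpha>\<^sub>0 < \<kappa>" "\<kappa> < \<mu>" "\<mu> < \<delta>" "is_card \<kappa>" "infinite {..<\<kappa>}"
    "is_card \<mu>" "infinite {..<\<mu>}" "r \<kappa> < \<mu>" "\<Phi> \<kappa> \<subseteq> \<Phi> \<mu>"
    by (rule ex_reflecting_pair[of \<Phi> r \<alpha>\<^sub>0, OF \<Phi> r \<alpha>\<^sub>0(1)])
  have \<kappa>: "good \<kappa>" and \<mu>: "good \<mu>" using \<kappa>\<mu> by (auto simp: good_def)
  have B: "B \<kappa> \<in> elts (S \<mu>)"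
    using bad[OF \<kappa>] \<kappa>\<mu>(8) \<kappa> V_below_iff unfolding S r_def bad_def by auto
  \<comment> \<open>\<theta> will send an element of \<open>X \<kappa>\<close> to the element of
    \<open>X \<mu>\<close> with the same code.\<close>
  have "\<exists>a'. a' \<in> U \<mu> \<and> i \<mu> a' = i \<kappa> a" if "a \<in> U \<kappa>" for a
  proof -
    have "(0, [i \<kappa> a]) \<in> \<Phi> \<mu>" using that \<Phi>0[OF \<kappa>] \<kappa>\<mu>(9) by blast
    then show ?thesis unfolding \<Phi>0[OF \<mu>] by auto
  qed
  then obtain \<theta> where \<theta>: "\<And>a. a \<in> U \<kappa> \<Longrightarrow> \<theta> a \<in> U \<mu>" "\<And>a. a \<in> U \<kappa> \<Longrightarrow> i \<mu> (\<theta> a) = i \<kappa> a"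
    by metis
  have seqs\<theta>: "map \<theta> as \<in> seqs (universe (X \<mu>)) n" if "as \<in> seqs (universe (X \<kappa>)) n" for as n
    using that \<theta>(1) by (auto simp: seqs_def U_def subset_iff)
  have map_eq: "as' = map \<theta> as"
    if "map (i \<kappa>) as = map (i \<mu>) as'" "as \<in> seqs (universe (X \<kappa>)) n" "as' \<in> seqs (universe (X \<mu>)) m" for as as' n m
  proof -
    have "map (i \<mu>) as' = map (i \<mu>) (map \<theta> as)" using that(1)[symmetric] that(2) \<theta>(2) by (auto simp: seqs_def U_def subset_iff)
    moreover have "set as' \<union> set (map \<theta> as) \<subseteq> U \<mu>" using that(2,3) \<theta>(1) by (auto simp: seqs_def U_def subset_iff)
    ultimately show ?thesis using i_inj[OF \<mu>] by (metis inj_on_map_eq_map inj_on_subset)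
  qed
  have \<theta>_fun: "\<theta> (fun_of (X \<kappa>) f as) = fun_of (X \<mu>) f (map \<theta> as)"
    if f: "f \<in> elts (Fsym L)" and as: "as \<in> seqs (universe (X \<kappa>)) (farity L f)" for f as
  proof -
    have "(Suc (2 * eF f), i \<kappa> (fun_of (X \<kappa>) f as) # map (i \<kappa>) as) \<in> \<Phi> \<mu>"
      using f as \<Phi>F[OF \<kappa>] \<kappa>\<mu>(9) by blast
    then obtain f' as' where f': "eF f = eF f'" "i \<kappa> (fun_of (X \<kappa>) f as) = i \<mu> (fun_of (X \<mu>) f' as')"
      "map (i \<kappa>) as = map (i \<mu>) as'" "f' \<in> elts (Fsym L)" "as' \<in> seqs (universe (X \<mu>)) (farity L f')"
      unfolding \<Phi>F[OF \<mu>] by auto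
    then have "f' = f" using eF f by (metis inj_onD)
    moreover have "as' = map \<theta> as" using map_eq f' as by blast
    ultimately have "i \<mu> (\<theta> (fun_of (X \<kappa>) f as)) = i \<mu> (fun_of (X \<mu>) f (map \<theta> as))"
      using f'(2) \<theta>(2) Xclosed[OF \<kappa> f as] by simp
    then show ?thesis
      using i_inj[OF \<mu>] \<theta>(1) Xclosed[OF \<kappa> f as] Xclosed[OF \<mu> f seqs\<theta>[OF as]] by (meson inj_onD)
  qed
  have \<theta>_rel: "rel_of (X \<mu>) s (map \<theta> as)"
    if s: "s \<in> elts (Rsym L)" and as: "as \<in> seqs (universe (X \<kappa>)) (rarity L s)" and "rel_of (X \<kappa>) s as" for s as
  proof -
    have "(Suc (Suc (2 * eR s)), map (i \<kappa>) as) \<in> \<Phi> \<mu>"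
      using that \<Phi>R[OF \<kappa>] \<kappa>\<mu>(9) by blast
    then obtain s' as' where s': "eR s = eR s'" "rel_of (X \<mu>) s' as'"
      "map (i \<kappa>) as = map (i \<mu>) as'" "s' \<in> elts (Rsym L)" "as' \<in> seqs (universe (X \<mu>)) (rarity L s')"
      unfolding \<Phi>R[OF \<mu>] by auto
    then have "s' = s" using eR s by (metis inj_onD)
    moreover have "as' = map \<theta> as" using map_eq s' as by blast
    ultimately show ?thesis using s'(2) by simp
  qed
  have X\<mu>: "U \<mu> \<subseteq> elts (universe (product L (S \<mu>)))"
    "\<And>f xs. f \<in> elts (Fsym L) \<Longrightarrow> xs \<in> seqs (universe (X \<mu>)) (farity L f) \<Longrightarrow> fun_of (X \<mu>) f xs = fun_of (product L (S \<mu>)) f xs"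
    "\<And>r xs. r \<in> elts (Rsym L) \<Longrightarrow> xs \<in> seqs (universe (X \<mu>)) (rarity L r) \<Longrightarrow> rel_of (X \<mu>) r xs \<longleftrightarrow> rel_of (product L (S \<mu>)) r xs"
    using Xsub[OF \<mu>] by (auto simp: substructure_def U_def)
  have seqs_sub: "xs \<in> seqs (universe (product L (S \<mu>))) n" if "xs \<in> seqs (universe (X \<mu>)) n" for xs n
    using that X\<mu>(1) by (auto simp: seqs_def U_def subset_iff)
  \<comment> \<open>\<theta> followed by the projection to \<open>B \<kappa>\<close>, a factor of
    the product since its rank is bounded below \<mu>.\<close>
  have "homomorphism L (\<lambda>a. app (\<theta> a) (B \<kappa>)) (X \<kappa>) (B \<kappa>)"
    unfolding homomorphism_def
  proof (intro conjI ballI impI)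
    show "(\<lambda>a. app (\<theta> a) (B \<kappa>)) ` elts (universe (X \<kappa>)) \<subseteq> elts (universe (B \<kappa>))"
      using app_universe_product[OF _ B] X\<mu>(1) \<theta>(1) by (auto simp: U_def)
  next
    fix f xs assume *: "f \<in> elts (Fsym L)" "xs \<in> seqs (universe (X \<kappa>)) (farity L f)"
    show "app (\<theta> (fun_of (X \<kappa>) f xs)) (B \<kappa>) = fun_of (B \<kappa>) f (map (\<lambda>a. app (\<theta> a) (B \<kappa>)) xs)"
      using \<theta>_fun[OF *] X\<mu>(2)[OF *(1) seqs\<theta>[OF *(2)]] fun_of_product[OF *(1) seqs_sub[OF seqs\<theta>[OF *(2)]] B]
      by (simp add: comp_def)
  next
    fix s xs assume *: "s \<in> elts (Rsym L)" "xs \<in> seqs (universe (X \<kappa>)) (rarity L s)" "rel_of (X \<kappa>) s xs"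
    show "rel_of (B \<kappa>) s (map (\<lambda>a. app (\<theta> a) (B \<kappa>)) xs)"
      using \<theta>_rel[OF *] X\<mu>(3)[OF *(1) seqs\<theta>[OF *(2)]] rel_of_product[OF *(1) seqs_sub[OF seqs\<theta>[OF *(2)]]] B
      by (auto simp: comp_def)
  qed
  then show False using bad[OF \<kappa>] by (auto simp: bad_def)
qed

section \<open>Reflection implies subtlety\<close>

text \<open>Symbols are coded by ordinals \<open>e n\<close>, later taken below all of
  \<open>D\<close>, so that they do not raise the ranks of the structures.\<close>

definition rel_language :: "(nat \<Rightarrow> 'v::zfc ord) \<Rightarrow> 'v language" where
  "rel_language e = \<lparr>Fsym = vset {}, Rsym = vset (range (\<lambda>s::sym. oset (e (to_nat s)))),
     farity = \<lambda>_. 0, rarity = \<lambda>_. 5\<rparr>"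

definition rel_structure ::
  "(nat \<Rightarrow> 'v::zfc ord) \<Rightarrow> 'v ord set \<Rightarrow> ('v ord \<Rightarrow> 'v ord set) \<Rightarrow> 'v ord \<Rightarrow> 'v" where
  "rel_structure e D E \<gamma> = mk_structure (rel_language e) (oset (osuc \<gamma>)) (\<lambda>_ _. vset {})
     (\<lambda>r xs. interp D E \<gamma> (SOME s. r = oset (e (to_nat s)))
        (Ord (xs ! 0)) (Ord (xs ! 1)) (Ord (xs ! 2)) (Ord (xs ! 3)) (Ord (xs ! 4)))"

locale incoherent_structures =
  fixes D :: "'v::zfc ord set" and E :: "'v ord \<Rightarrow> 'v ord set" and w :: "'v ord" and e :: "nat \<Rightarrow> 'v ord"
  assumes D_gt: "\<gamma> \<in> D \<Longrightarrow> w < \<gamma>" and inj_e: "inj e" and e_less: "e n < w"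
begin

abbreviation "L \<equiv> rel_language e"
abbreviation "sym_code s \<equiv> oset (e (to_nat (s::sym)))"
abbreviation "M \<equiv> rel_structure e D E"

lemma Fsym [simp]: "elts (Fsym L) = {}"
  by (simp add: rel_language_def elts_vset)

lemma Rsym: "elts (Rsym L) = range sym_code"
  unfolding rel_language_def using e_less
  by (auto intro!: elts_vset small_subset[OF small_elts[of "oset w"]])

lemma rarity [simp]: "rarity L r = 5"
  by (simp add: rel_language_def)

lemma sym_code_inj: "sym_code s = sym_code t \<longleftrightarrow> s = t"
  using inj_e by (auto simp: oset_inject inj_eq)

lemma countable_language_L: "countable_language L"
  by (simp add: countable_language_def Rsym)

lemma universe_M: "elts (universe (M \<gamma>)) = oset ` {..\<gamma>}"
  by (simp add: rel_structure_def elts_osuc)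

lemma is_structure_M: "is_structure L (M \<gamma>)"
  unfolding rel_structure_def by (rule is_structure_mk_structure) (simp_all add: elts_osuc)

lemma inj_M: "M \<beta> = M \<gamma> \<longleftrightarrow> \<beta> = \<gamma>"
proof
  assume "M \<beta> = M \<gamma>"
  then have "oset ` {..\<beta>} = oset ` {..\<gamma>}" by (metis universe_M)
  then have "{..\<beta>} = {..\<gamma>}" by (simp only: inj_image_eq_iff[OF inj_oset])
  then show "\<beta> = \<gamma>" by simp
qed simp

lemma rel_of_M:
  assumes "a \<le> \<gamma>" "b \<le> \<gamma>" "c \<le> \<gamma>" "d \<le> \<gamma>" "f \<le> \<gamma>"
  shows "rel_of (M \<gamma>) (sym_code s) [oset a, oset b, oset c, oset d, oset f] \<longleftrightarrow> interp D E \<gamma> s a b c d f"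
proof -
  have "(SOME t. sym_code s = sym_code t) = s" unfolding sym_code_inj by simp
  moreover have "sym_code s \<in> elts (Rsym L)" by (simp add: Rsym)
  moreover have "[oset a, oset b, oset c, oset d, oset f] \<in> seqs (oset (osuc \<gamma>)) (rarity L (sym_code s))"
    using assms by (simp add: seqs_def elts_osuc)
  ultimately show ?thesis
    unfolding rel_structure_def by (simp add: rel_of_mk_structure oset_inverse eval_nat_numeral)
qed

text \<open>\<open>M \<gamma>\<close> lies finitely many levels above \<gamma> and \<kappa> is a
  limit; conversely, its first component is the successor of \<gamma>.\<close>

lemma M_V_below:
  assumes "\<gamma> \<in> D" "is_card \<kappa>" "infinite {..<\<kappa>}"
  shows "M \<gamma> \<in> V_below \<kappa> \<longleftrightarrow> \<gamma> < \<kappa>"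
proof
  assume "M \<gamma> \<in> V_below \<kappa>"
  then have "oset (osuc \<gamma>) \<in> V_below \<kappa>"
    unfolding rel_structure_def mk_structure_def by (rule opair_V_belowD)
  then have "osuc \<gamma> < \<kappa>" by simp
  moreover have "\<gamma> < osuc \<gamma>" by simp
  ultimately show "\<gamma> < \<kappa>" by order
next
  assume "\<gamma> < \<kappa>"
  note osuc_pow_less = osuc_pow_less_card[OF assms(2,3)]
  \<comment> \<open>One successor for the universe of \<open>M \<gamma>\<close> and two for each of
    the five entries of a tuple.\<close>
  define a where "a = (osuc ^^ 11) \<gamma>"
  have "\<gamma> < a" "osuc \<gamma> \<le> a" by (simp_all add: a_def eval_nat_numeral less_imp_le)
  have "w < \<gamma>" using D_gt assms by blast
  have zero: "vset {} \<in> V_below \<beta>" if "\<gamma> \<le> \<beta>" for \<beta>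
    using \<open>w < \<gamma>\<close> that by (subst V_below_iff) (auto simp: elts_vset intro: less_le_trans)
  have tuples: "tuple xs \<in> V_below a" if "xs \<in> seqs (oset (osuc \<gamma>)) 5" for xs
  proof -
    have "set xs \<subseteq> V_below (osuc \<gamma>)" using that by (auto simp: seqs_def elts_osuc)
    then have "tuple xs \<in> V_below ((osuc ^^ (2 * length xs)) (osuc \<gamma>))"
      by (rule tuple_V_below) (simp add: zero less_imp_le)
    also have "(osuc ^^ (2 * length xs)) (osuc \<gamma>) = a"
      using that by (simp add: seqs_def a_def eval_nat_numeral)
    finally show ?thesis .
  qed
  have graph_in: "graph (Rsym L) (\<lambda>r. vset {tuple xs |xs. xs \<in> seqs (oset (osuc \<gamma>)) (rarity L r) \<and> R r xs})
      \<in> V_below \<kappa>" for R :: "'v \<Rightarrow> 'v list \<Rightarrow> bool"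
  proof -
    have "opair r (vset {tuple xs |xs. xs \<in> seqs (oset (osuc \<gamma>)) (rarity L r) \<and> R r xs})
      \<in> V_below (osuc (osuc (osuc a)))" if "r \<in> elts (Rsym L)" for r
    proof (rule opair_V_below)
      obtain n where "r = oset (e n)" using \<open>r \<in> elts (Rsym L)\<close> by (auto simp: Rsym)
      then show "r \<in> V_below (osuc a)" using e_less[of n] \<open>w < \<gamma>\<close> \<open>\<gamma> < a\<close> by (simp add: less_imp_le)
      have "small {tuple xs |xs. xs \<in> seqs (oset (osuc \<gamma>)) (rarity L r) \<and> R r xs}"
        by (rule small_subset[OF small_tuples[of "oset (osuc \<gamma>)" 5]]) auto
      then show "vset {tuple xs |xs. xs \<in> seqs (oset (osuc \<gamma>)) (rarity L r) \<and> R r xs} \<in> V_below (osuc a)"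
        using tuples by (auto simp: V_below_osuc elts_vset)
    qed
    then have "elts (graph (Rsym L) (\<lambda>r. vset {tuple xs |xs. xs \<in> seqs (oset (osuc \<gamma>)) (rarity L r) \<and> R r xs}))
      \<subseteq> V_below (osuc (osuc (osuc a)))" by (auto simp: elts_graph)
    moreover have "osuc (osuc (osuc a)) < \<kappa>"
      using osuc_pow_less[OF \<open>\<gamma> < \<kappa>\<close>, of 14] by (simp add: a_def eval_nat_numeral)
    ultimately show ?thesis using V_below_iff by blast
  qed
  have pair: "opair x y \<in> V_below \<kappa>" if xy: "x \<in> V_below \<kappa>" "y \<in> V_below \<kappa>" for x y
  proof -
    obtain b c where "b < \<kappa>" "elts x \<subseteq> V_below b" "c < \<kappa>" "elts y \<subseteq> V_below c" using xy V_below_iff by meson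
    then have "x \<in> V_below (osuc (max b c))" "y \<in> V_below (osuc (max b c))"
      using V_below_mono[of b "max b c"] V_below_mono[of c "max b c"] unfolding V_below_osuc by auto
    then have "opair x y \<in> V_below ((osuc ^^ 3) (max b c))"
      using opair_V_below by (simp add: eval_nat_numeral)
    moreover have "(osuc ^^ 3) (max b c) < \<kappa>" using \<open>b < \<kappa>\<close> \<open>c < \<kappa>\<close> by (intro osuc_pow_less) simp
    ultimately show ?thesis using V_below_mono[OF less_imp_le] by blast
  qed
  have "graph (Fsym L) F \<in> V_below \<kappa>" for F :: "'v \<Rightarrow> 'v"
    using zero[of \<kappa>] \<open>\<gamma> < \<kappa>\<close> by (simp add: graph_def)
  moreover have "oset (osuc \<gamma>) \<in> V_below \<kappa>" using osuc_pow_less[OF \<open>\<gamma> < \<kappa>\<close>, of 1] by simp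
  ultimately show "M \<gamma> \<in> V_below \<kappa>"
    unfolding rel_structure_def mk_structure_def by (intro pair graph_in)
qed

text \<open>No member of \<open>D\<close> is at least \<kappa> and below \<open>K\<close>, so the
  structures in \<open>V_below \<kappa>\<close> are those with index below \<open>K\<close>. A
  homomorphism from the substructure given by \<open>elems\<close> would contradict
  \<open>no_hom\<close>.\<close>

lemma not_WPSR:
  assumes K: "incoherent D E K" and \<kappa>: "is_card \<kappa>" "infinite {..<\<kappa>}" "\<kappa> \<le> K"
    and least: "\<And>\<gamma>. \<gamma> \<in> D \<Longrightarrow> \<kappa> \<le> \<gamma> \<Longrightarrow> K \<le> \<gamma>" and D: "D \<subseteq> {..<\<delta>}"
  shows "\<not> WPSR L (M ` D) (oset \<kappa>)"
proof
  assume WPSR: "WPSR L (M ` D) (oset \<kappa>)"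
  interpret incoherent D E K by fact
  define I where "I = {\<gamma>\<in>D. \<gamma> < K}"
  have I_iff: "\<gamma> \<in> I \<longleftrightarrow> \<gamma> \<in> D \<and> \<gamma> < \<kappa>" for \<gamma>
    using least[of \<gamma>] \<kappa>(3) unfolding I_def by (auto simp: not_le[symmetric] intro: order.trans)
  have MI: "M ` D \<inter> V_below \<kappa> = M ` I" using M_V_below \<kappa> by (auto simp: I_iff)
  define S where "S = vset (M ` D \<inter> V_below \<kappa>)"
  have S: "elts S = M ` I"
    unfolding S_def MI[symmetric] by (rule elts_vset) (rule small_subset[OF small_elts[of "Vlev (oset \<kappa>)"]], simp)
  define idx where "idx \<A> = (THE \<gamma>. \<A> = M \<gamma>)" for \<A>
  have idx: "idx (M \<gamma>) = \<gamma>" for \<gamma> by (simp add: idx_def inj_M)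
  define G where "G f = graph S (\<lambda>\<A>. oset (f (idx \<A>)))" for f
  have app_G: "app (G f) (M \<gamma>) = oset (f \<gamma>)" if "\<gamma> \<in> I" for f \<gamma>
    using that by (simp add: G_def S idx)
  have I_ne: "I \<noteq> {}" using WPSR MI by (auto simp: WPSR_def)
  have elems_le: "f \<gamma> \<le> \<gamma>" if "f \<in> elems" "\<gamma> \<in> I" for f \<gamma>
  proof -
    have \<gamma>: "\<gamma> \<in> D" "\<gamma> < K" using that by (auto simp: I_def)
    have d: "desc l \<gamma> \<in> D" "desc l \<gamma> \<le> \<gamma>" if "l \<in> lists (D \<inter> {..K})" for l
      using that \<gamma> desc_mem[of \<gamma> \<gamma> l] by (auto simp: subset_iff in_lists_conv_set)
    moreover have "diff \<eta> (desc l \<gamma>) \<le> \<gamma>" if "\<eta> \<in> D" "l \<in> lists (D \<inter> {..K})" for \<eta> l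
      using diff_less[of "desc l \<gamma>" \<eta>] d[OF that(2)] \<gamma> that(1) by fastforce
    ultimately show ?thesis using \<open>f \<in> elems\<close> by (auto simp: elems_def cut_def)
  qed
  have G_in: "G f \<in> elts (product_universe S)" if "f \<in> elems" for f
    unfolding elts_product_universe using elems_le[OF that] by (auto simp: G_def S idx universe_M)
  define U where "U = vset (G ` elems)"
  have U: "elts U = G ` elems" unfolding U_def
    by (rule elts_vset) (rule small_subset[OF small_elts[of "product_universe S"]], use G_in in blast)
  define X where "X = mk_structure L U (\<lambda>_ _. vset {}) (rel_of (product L S))"
  have X_univ: "universe X = U" by (simp add: X_def)
  have X_rel: "rel_of X r xs \<longleftrightarrow> rel_of (product L S) r xs" if "r \<in> elts (Rsym L)" "xs \<in> seqs U 5" for r xs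
    unfolding X_def using that by (simp add: rel_of_mk_structure)
  have "elems \<noteq> {}" by (auto simp: elems_def)
  then have "is_structure L X" unfolding X_def by (intro is_structure_mk_structure) (auto simp: U)
  then have X_sub: "substructure L X (product L S)"
    unfolding substructure_def X_univ using G_in X_rel by (auto simp: U product_def)
  have "elts (universe X) \<lesssim> elts (oset \<kappa>)"
  proof -
    note inf = \<kappa>(2)
    have ins: "insert K {..<\<kappa>} \<lesssim> {..<\<kappa>}"
      using infinite_insert_eqpoll[OF inf] by (rule eqpoll_imp_lepoll)
    have DK: "D \<inter> {..K} \<subseteq> insert K {..<\<kappa>}" using least by force
    have "lists (D \<inter> {..K}) \<lesssim> lists (insert K {..<\<kappa>})"
      by (rule subset_imp_lepoll[OF lists_mono[OF DK]])
    also have "\<dots> \<lesssim> insert K {..<\<kappa>}" using inf by (intro lists_lepoll_infinite) simp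
    also note ins
    finally have lists: "lists (D \<inter> {..K}) \<lesssim> {..<\<kappa>}" .
    \<comment> \<open>All coordinates are below \<kappa>, so truncations at or above \<kappa>
      coincide in the product.\<close>
    have G_cut: "G (cut \<alpha>) = G (cut K)" if "\<kappa> \<le> \<alpha>" for \<alpha>
    proof -
      have "cut \<alpha> \<gamma> = cut K \<gamma>" if "\<gamma> \<in> I" for \<gamma>
      proof -
        have "\<gamma> < \<alpha>" "\<gamma> < K" using \<open>\<kappa> \<le> \<alpha>\<close> that \<kappa>(3) unfolding I_iff by (auto intro: less_le_trans)
        then show ?thesis by (auto simp: cut_def min_def)
      qed
      then show ?thesis unfolding G_def graph_def by (intro arg_cong[of _ _ vset] image_cong) (auto simp: S idx)
    qed
    have "G (cut \<alpha>) \<in> (\<lambda>\<alpha>. G (cut \<alpha>)) ` insert K {..<\<kappa>}" for \<alpha>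
      by (cases "\<kappa> \<le> \<alpha>") (simp_all add: G_cut not_le)
    then have "G ` cut ` {..K} \<subseteq> (\<lambda>\<alpha>. G (cut \<alpha>)) ` insert K {..<\<kappa>}" by blast
    then have 1: "G ` cut ` {..K} \<lesssim> {..<\<kappa>}" using ins by (rule lepoll_trans[OF subset_image_lepoll])
    have 2: "G ` desc ` lists (D \<inter> {..K}) \<lesssim> {..<\<kappa>}"
      by (rule lepoll_trans[OF lepoll_trans[OF image_lepoll image_lepoll] lists])
    have "D \<inter> {..K} \<lesssim> {..<\<kappa>}" using subset_imp_lepoll[OF DK] ins by (rule lepoll_trans)
    then have "(D \<inter> {..K}) \<times> lists (D \<inter> {..K}) \<lesssim> {..<\<kappa>}" using lists inf by (intro times_lepoll_infinite)
    then have 3: "G ` (\<lambda>(\<eta>, l). \<lambda>\<beta>. diff \<eta> (desc l \<beta>)) ` ((D \<inter> {..K}) \<times> lists (D \<inter> {..K})) \<lesssim> {..<\<kappa>}"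
      by (rule lepoll_trans[OF lepoll_trans[OF image_lepoll image_lepoll]])
    have "G ` elems \<lesssim> {..<\<kappa>}"
      unfolding elems_def image_Un by (intro Un_lepoll_infinite inf 1 2 3)
    then show ?thesis unfolding X_univ U using elts_oset_eqpoll by (meson eqpoll_sym lepoll_trans2)
  qed
  then obtain h where h: "homomorphism L h X (M K)"
    using WPSR X_sub K unfolding WPSR_def S_def by blast
  have hG: "h (G f) \<in> oset ` {..K}" if "f \<in> elems" for f
    using h that unfolding homomorphism_def X_univ U universe_M by blast
  define k where "k f = Ord (h (G f))" for f
  have k: "h (G f) = oset (k f)" "k f \<le> K" if "f \<in> elems" for f
    using hG[OF that] by (auto simp: k_def oset_inverse)
  show False
  proof (rule no_hom)
    show "\<exists>\<gamma>\<in>D. \<gamma> < K" using I_ne by (auto simp: I_def)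
    show "k a \<le> K" if "a \<in> elems" for a using k that by blast
    fix s a b c d f
    assume in5: "{a, b, c, d, f} \<subseteq> elems" and int: "\<And>\<beta>. \<beta> \<in> D \<Longrightarrow> \<beta> < K \<Longrightarrow> interp D E \<beta> s (a \<beta>) (b \<beta>) (c \<beta>) (d \<beta>) (f \<beta>)"
    have s: "sym_code s \<in> elts (Rsym L)" by (simp add: Rsym)
    let ?xs = "[G a, G b, G c, G d, G f]"
    have xs: "?xs \<in> seqs U 5" using in5 by (auto simp: seqs_def U)
    have xs': "?xs \<in> seqs (universe (product L S)) 5" using in5 G_in by (auto simp: seqs_def product_def)
    have "rel_of (product L S) (sym_code s) ?xs"
      using s xs' in5 elems_le int by (subst rel_of_product) (auto simp: S app_G rel_of_M I_def)
    then have "rel_of X (sym_code s) ?xs" using X_rel[OF s xs] by blast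
    then have "rel_of (M K) (sym_code s) (map h ?xs)"
      using h s xs unfolding homomorphism_def X_univ rarity by blast
    then show "interp D E K s (k a) (k b) (k c) (k d) (k f)"
      using in5 by (simp add: k rel_of_M)
  qed
qed

end

lemma WPSR_imp_coherent:
  fixes \<delta> :: "'v::zfc ord"
  assumes card: "is_card \<delta>" and unc: "uncountable {..<\<delta>}"
    and WPSR: "\<And>(L :: 'v language) \<C>. countable_language L \<Longrightarrow> elts \<C> \<noteq> {} \<Longrightarrow> \<forall>\<A>\<in>elts \<C>. is_structure L \<A> \<Longrightarrow>
      elts \<C> \<subseteq> V_below \<delta> \<Longrightarrow> \<exists>\<kappa><\<delta>. is_card \<kappa> \<and> infinite {..<\<kappa>} \<and> WPSR L (elts \<C>) (oset \<kappa>)"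
  shows "coherent_below \<delta>"
  unfolding coherent_below_def
proof (intro allI impI, rule ccontr)
  fix E and C :: "'v ord set"
  assume EC: "(\<forall>\<gamma><\<delta>. E \<gamma> \<subseteq> {..<\<gamma>}) \<and> club_in \<delta> C"
    and no: "\<not> (\<exists>\<beta>\<in>C. \<exists>\<gamma>\<in>C. \<beta> < \<gamma> \<and> E \<beta> = E \<gamma> \<inter> {..<\<beta>})"
  have inf: "infinite {..<\<delta>}" using unc countable_finite by blast
  obtain w where w: "w < \<delta>" "infinite {..<w}" using infinite_below_uncountable[OF unc] by blast
  obtain e :: "nat \<Rightarrow> 'v ord" where e: "inj e" "range e \<subseteq> {..<w}"
    using w(2) infinite_countable_subset by blast
  \<comment> \<open>Discarding the club up to \<open>w\<close> keeps every index above the codes of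
    the relation symbols.\<close>
  define D where "D = {\<gamma> \<in> C. w < \<gamma>}"
  interpret incoherent_structures D E w e
    by standard (use e in \<open>auto simp: D_def\<close>)
  have D_sub: "D \<subseteq> {..<\<delta>}" using EC by (auto simp: D_def club_in_def)
  have D_unb: "\<exists>\<gamma>\<in>D. \<xi> < \<gamma>" if "\<xi> < \<delta>" for \<xi>
  proof -
    have "max \<xi> w < \<delta>" using that w by simp
    then obtain \<gamma> where "\<gamma> \<in> C" "max \<xi> w < \<gamma>" using EC unfolding club_in_def by blast
    then show ?thesis by (auto simp: D_def)
  qed
  define \<C> where "\<C> = vset (M ` D)"
  have "M ` D = (\<lambda>x. M (Ord x)) ` oset ` D" by (simp add: image_image oset_inverse)
  then have "small (M ` D)" using small_image[OF small_ords[OF D_sub]] by simp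
  then have \<C>: "elts \<C> = M ` D" unfolding \<C>_def by (rule elts_vset)
  have "elts \<C> \<noteq> {}" using D_unb w by (auto simp: \<C>)
  moreover have "\<forall>\<A>\<in>elts \<C>. is_structure L \<A>" by (auto simp: \<C> is_structure_M)
  moreover have "elts \<C> \<subseteq> V_below \<delta>" using M_V_below card inf D_sub by (auto simp: \<C>)
  ultimately obtain \<kappa> where \<kappa>: "\<kappa> < \<delta>" "is_card \<kappa>" "infinite {..<\<kappa>}" "WPSR L (M ` D) (oset \<kappa>)"
    using WPSR[OF countable_language_L] \<C> by metis
  \<comment> \<open>\<open>K\<close> may be \<kappa> itself, since \<open>M \<kappa>\<close> lies
    outside \<open>V_below \<kappa>\<close>.\<close>
  define K where "K = (LEAST \<gamma>. \<gamma> \<in> D \<and> \<kappa> \<le> \<gamma>)"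
  obtain \<gamma> where "\<gamma> \<in> D" "\<kappa> < \<gamma>" using D_unb \<kappa>(1) by blast
  then have K: "K \<in> D" "\<kappa> \<le> K" using LeastI[of "\<lambda>\<gamma>. \<gamma> \<in> D \<and> \<kappa> \<le> \<gamma>" \<gamma>] by (auto simp: K_def)
  have "incoherent D E K"
  proof
    show "K \<in> D" by fact
    show "E \<gamma> \<subseteq> {..<\<gamma>}" if "\<gamma> \<in> D" for \<gamma> using that EC D_sub by blast
    show "E \<beta> \<noteq> E \<gamma> \<inter> {..<\<beta>}" if "\<beta> \<in> D" "\<gamma> \<in> D" "\<beta> < \<gamma>" for \<beta> \<gamma> using no that by (auto simp: D_def)
    fix \<mu> \<xi> assume \<mu>: "\<mu> < K" "\<xi> < \<mu>" "\<And>\<xi>. \<xi> < \<mu> \<Longrightarrow> \<exists>\<beta>\<in>D. \<xi> < \<beta> \<and> \<beta> < \<mu>"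
    then have "w < \<mu>" unfolding D_def by (metis (no_types, lifting) less_trans mem_Collect_eq)
    moreover have "\<mu> < \<delta>" using \<mu>(1) K(1) D_sub by auto
    moreover have "\<exists>\<beta>\<in>C. \<xi> < \<beta> \<and> \<beta> < \<mu>" if "\<xi> < \<mu>" for \<xi> using \<mu>(3)[OF that] by (auto simp: D_def)
    ultimately show "\<mu> \<in> D" using EC \<mu>(2) unfolding D_def club_in_def by blast
  qed
  moreover have "K \<le> \<gamma>" if "\<gamma> \<in> D" "\<kappa> \<le> \<gamma>" for \<gamma> unfolding K_def using that by (intro Least_le) simp
  ultimately show False using not_WPSR[OF _ \<kappa>(2,3) K(2) _ D_sub] \<kappa>(4) by blast
qed

text \<open>For empty \<C> the first clause of \<open>WPSR\<close> fails at every \<kappa>, whence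
  the restriction to nonempty sets.\<close>

theorem theorem1p34:
  fixes \<delta> :: "'v::zfc"
  assumes "cardinal \<delta>" and "uncountable (elts \<delta>)"
  shows "subtle \<delta> \<longleftrightarrow>
    (\<forall>(L :: 'v language) \<C>.
      countable_language L \<and> elts \<C> \<noteq> {} \<and> (\<forall>\<A>\<in>elts \<C>. is_structure L \<A>) \<and>
      elts \<C> \<subseteq> elts (Vlev \<delta>) \<longrightarrow>
      (\<exists>\<kappa>\<in>elts \<delta>. cardinal \<kappa> \<and> infinite (elts \<kappa>) \<and> WPSR L (elts \<C>) \<kappa>))"
proof -
  define d where "d = Ord \<delta>"
  have \<delta>: "\<delta> = oset d" using assms(1) by (simp add: d_def cardinal_def)
  have card: "is_card d" using assms(1) by (simp add: \<delta> cardinal_oset)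
  have unc: "uncountable {..<d}" using assms(2) countable_eqpoll[OF _ elts_oset_eqpoll] unfolding \<delta> by blast
  then have inf: "infinite {..<d}" using countable_finite by blast
  show ?thesis
    unfolding \<delta> subtle_oset bex_elts_oset cardinal_oset finite_elts_oset
    using card inf coherent_imp_WPSR[OF card unc] WPSR_imp_coherent[OF card unc] by blast
qed

end
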